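(* Let $\Gamma$ be a ${\mathbb{Z}}$-tropical curve of genus $g \geq 2$, and let $D$ be a ${\mathbb{Z}}$-divisor on $\Gamma$ of degree $d \geq 2$. Assume that there exist an edge $e$ of the canonical model of $\Gamma$ and a positive integer $n$ such that $e$ is not a bridge and $nD$ is linearly equivalent to $\frac{nd}{2}[p] + \frac{nd}{2}[q]$, where $p$ and $q$ are the endpoints of $e$. Then the graded semi-ring $\bigoplus_{m=0}^\infty R(\Gamma, mD)$ is not finitely generated as a graded semi-ring over ${\mathbb{R}}^{\mathrm{trop}}$.
   Context: Finite graphs are connected and may have loops and multiple edges; a bridge is an edge whose removal disconnects the graph. A tropical curve $\Gamma$ is a metric space obtained from a finite graph $G$ and a length function $l: E(G) \to {\mathbb{R}}_{>0} \cup \{\infty\}$ by gluing intervals $[0,l(e)]$ according to the combinatorics of $G$, where only edges adjacent to one-valent vertices may have length $\infty$; it is assumed that $\Gamma$ is not homeomorphic to a circle. The valence $\mathrm{val}(x)$ of $x \in \Gamma$ is the number of connected components of $U_x \setminus \{x\}$ for a small neighborhood $U_x$. The canonical model $(G,l)$ of $\Gamma$ has as vertices exactly the points of valence $\neq 2$ and as edges the components of the complement. The genus $g$ is the first Betti number of $\Gamma$. $\Gamma$ is a ${\mathbb{Z}}$-tropical curve if every edge length in its canonical model is an integer or $\infty$; its ${\mathbb{Z}}$-points are the points at integer distance from the vertices of the canonical model. A divisor is a finite formal ${\mathbb{Z}}$-linear combination $D=\sum D(x)[x]$ of points; its degree is $\sum D(x)$; it is effective if all $D(x)\ge 0$; it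 is a ${\mathbb{Z}}$-divisor if its support consists of ${\mathbb{Z}}$-points. A rational function is a continuous function $f:\Gamma\to{\mathbb{R}}\cup\{\pm\infty\}$, piecewise linear with finitely many pieces and integer slopes, taking values $\pm\infty$ only at one-valent points; $\mathrm{ord}_x(f)$ is the sum of the outgoing slopes of $f$ at $x$, and $\mathrm{div}(f)=\sum_x \mathrm{ord}_x(f)[x]$. Divisors $D,D'$ are linearly equivalent if $D-D'=\mathrm{div}(f)$ for some rational $f$. $R(\Gamma,D)=\{f \text{ rational}: D+\mathrm{div}(f)\ge 0\}$. ${\mathbb{R}}^{\mathrm{trop}}=({\mathbb{R}},\max,+)$. The direct sum $\bigoplus_{m\ge0}R(\Gamma,mD)$ is a graded semi-ring over ${\mathbb{R}}^{\mathrm{trop}}$ with sum $(f\oplus g)(x)=\max\{f(x),g(x)\}$ within each degree, scalar action $(c\odot f)(x)=c+f(x)$, and product $(f\odot g)(x)=f(x)+g(x)$ sending degrees $n,k$ to degree $n+k$. It is finitely generated if there are finitely many homogeneous elements such that every homogeneous element is a finite tropical sum of ${\mathbb{R}}^{\mathrm{trop}}$-multiples of tropical products of these elements. *)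

theory Defs
  imports Complex_Main "HOL-Library.Extended_Real"
begin

text \<open>A tropical curve is given by its canonical model: a finite connected multigraph
  (loops allowed) with edge lengths in (0, infinity].  Each edge e is parametrised by
  [0, len e], with parameter 0 at src e and parameter len e at tgt e.  An edge of
  infinite length has its end at infinity (a one-valent vertex) as tgt.\<close>

record ('v, 'e) metric_graph =
  verts :: "'v set"
  edges :: "'e set"
  src :: "'e \<Rightarrow> 'v"
  tgt :: "'e \<Rightarrow> 'v"
  len :: "'e \<Rightarrow> ereal"

text \<open>Points of the curve: vertices, or interior points of edges at parameter t.\<close>
datatype ('v, 'e) point = Vx 'v | Ix 'e real

definition adj :: "('v, 'e) metric_graph \<Rightarrow> 'e set \<Rightarrow> ('v \<times> 'v) set" where
  "adj G E = {(src G e, tgt G e) | e. e \<in> E} \<union> {(tgt G e, src G e) | e. e \<in> E}"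

definition graph_connected :: "('v, 'e) metric_graph \<Rightarrow> 'e set \<Rightarrow> bool" where
  "graph_connected G E \<longleftrightarrow> (\<forall>u\<in>verts G. \<forall>w\<in>verts G. (u, w) \<in> (adj G E)\<^sup>*)"

definition is_bridge :: "('v, 'e) metric_graph \<Rightarrow> 'e \<Rightarrow> bool" where
  "is_bridge G e \<longleftrightarrow> \<not> graph_connected G (edges G - {e})"

text \<open>Valence of a vertex (a loop counts twice).\<close>
definition valence :: "('v, 'e) metric_graph \<Rightarrow> 'v \<Rightarrow> nat" where
  "valence G v = card {e \<in> edges G. src G e = v} + card {e \<in> edges G. tgt G e = v}"

text \<open>Canonical model of a tropical curve.\<close>
definition tropical_curve :: "('v, 'e) metric_graph \<Rightarrow> bool" where
  "tropical_curve G \<longleftrightarrow>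
     finite (verts G) \<and> verts G \<noteq> {} \<and> finite (edges G) \<and>
     (\<forall>e\<in>edges G. src G e \<in> verts G \<and> tgt G e \<in> verts G \<and> 0 < len G e) \<and>
     (\<forall>e\<in>edges G. len G e = \<infinity> \<longrightarrow> src G e \<noteq> tgt G e \<and> valence G (tgt G e) = 1) \<and>
     graph_connected G (edges G) \<and>
     (\<forall>v\<in>verts G. valence G v \<noteq> 2)"

definition Z_tropical_curve :: "('v, 'e) metric_graph \<Rightarrow> bool" where
  "Z_tropical_curve G \<longleftrightarrow> tropical_curve G \<and>
     (\<forall>e\<in>edges G. len G e = \<infinity> \<or> (\<exists>k::int. len G e = ereal (of_int k)))"

definition genus :: "('v, 'e) metric_graph \<Rightarrow> int" where
  "genus G = int (card (edges G)) - int (card (verts G)) + 1"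

definition pts :: "('v, 'e) metric_graph \<Rightarrow> ('v, 'e) point set" where
  "pts G = Vx ` verts G \<union> {Ix e t | e t. e \<in> edges G \<and> 0 < t \<and> ereal t < len G e}"

definition inf_end :: "('v, 'e) metric_graph \<Rightarrow> 'v \<Rightarrow> bool" where
  "inf_end G v \<longleftrightarrow> (\<exists>e\<in>edges G. len G e = \<infinity> \<and> tgt G e = v)"

text \<open>Points that are not points at infinity.\<close>
definition fin_pts :: "('v, 'e) metric_graph \<Rightarrow> ('v, 'e) point set" where
  "fin_pts G = pts G - {Vx v | v. inf_end G v}"

definition Z_points :: "('v, 'e) metric_graph \<Rightarrow> ('v, 'e) point set" where
  "Z_points G = Vx ` verts G \<union> {Ix e t | e t. Ix e t \<in> pts G \<and> t \<in> \<int>}"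

text \<open>Divisors: finitely supported integer functions on the points.\<close>
definition divisor :: "('v, 'e) metric_graph \<Rightarrow> (('v, 'e) point \<Rightarrow> int) \<Rightarrow> bool" where
  "divisor G D \<longleftrightarrow> finite {x. D x \<noteq> 0} \<and> {x. D x \<noteq> 0} \<subseteq> pts G"

definition Z_divisor :: "('v, 'e) metric_graph \<Rightarrow> (('v, 'e) point \<Rightarrow> int) \<Rightarrow> bool" where
  "Z_divisor G D \<longleftrightarrow> divisor G D \<and> {x. D x \<noteq> 0} \<subseteq> Z_points G"

definition deg :: "(('v, 'e) point \<Rightarrow> int) \<Rightarrow> int" where
  "deg D = (\<Sum>x\<in>{x. D x \<noteq> 0}. D x)"

definition point_at :: "('v, 'e) metric_graph \<Rightarrow> 'e \<Rightarrow> real \<Rightarrow> ('v, 'e) point" where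
  "point_at G e t = (if t = 0 then Vx (src G e) else if ereal t = len G e then Vx (tgt G e) else Ix e t)"

definition edge_fun :: "('v, 'e) metric_graph \<Rightarrow> (('v, 'e) point \<Rightarrow> ereal) \<Rightarrow> 'e \<Rightarrow> real \<Rightarrow> real" where
  "edge_fun G f e t = real_of_ereal (f (point_at G e t))"

text \<open>g is piecewise linear with finitely many pieces and integer slopes on [0, L]
  (on [0, infinity) if L is infinite).\<close>
definition pw_linear :: "(real \<Rightarrow> real) \<Rightarrow> ereal \<Rightarrow> bool" where
  "pw_linear g L \<longleftrightarrow> (\<exists>bs :: real list.
     bs \<noteq> [] \<and> sorted_wrt (<) bs \<and> hd bs = 0 \<and>
     (L \<noteq> \<infinity> \<longrightarrow> ereal (last bs) = L) \<and>
     (\<forall>i < length bs - 1. \<exists>s::int. \<forall>t\<in>{bs ! i .. bs ! (i + 1)}.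
         g t = g (bs ! i) + of_int s * (t - bs ! i)) \<and>
     (L = \<infinity> \<longrightarrow> (\<exists>s::int. \<forall>t \<ge> last bs. g t = g (last bs) + of_int s * (t - last bs))))"

definition rational_fun :: "('v, 'e) metric_graph \<Rightarrow> (('v, 'e) point \<Rightarrow> ereal) \<Rightarrow> bool" where
  "rational_fun G f \<longleftrightarrow>
     (\<forall>x\<in>fin_pts G. \<bar>f x\<bar> \<noteq> \<infinity>) \<and>
     (\<forall>e\<in>edges G. pw_linear (edge_fun G f e) (len G e)) \<and>
     (\<forall>e\<in>edges G. len G e = \<infinity> \<longrightarrow>
        ((\<lambda>t. f (point_at G e t)) \<longlongrightarrow> f (Vx (tgt G e))) at_top)"

definition rslope :: "(real \<Rightarrow> real) \<Rightarrow> real \<Rightarrow> real" where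
  "rslope g t = (THE s. (g has_real_derivative s) (at t within {t..}))"

definition lslope :: "(real \<Rightarrow> real) \<Rightarrow> real \<Rightarrow> real" where
  "lslope g t = (THE s. (g has_real_derivative s) (at t within {..t}))"

definition end_slope :: "(real \<Rightarrow> real) \<Rightarrow> real" where
  "end_slope g = (THE s. \<exists>T. \<forall>t \<ge> T. g t = g T + s * (t - T))"

text \<open>ord_x(f): sum of outgoing slopes of f at x.\<close>
definition ord :: "('v, 'e) metric_graph \<Rightarrow> (('v, 'e) point \<Rightarrow> ereal) \<Rightarrow> ('v, 'e) point \<Rightarrow> real" where
  "ord G f x = (case x of
      Ix e t \<Rightarrow> rslope (edge_fun G f e) t - lslope (edge_fun G f e) t
    | Vx v \<Rightarrow> (\<Sum>e\<in>{e \<in> edges G. src G e = v}. rslope (edge_fun G f e) 0)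
            - (\<Sum>e\<in>{e \<in> edges G. tgt G e = v \<and> len G e \<noteq> \<infinity>}.
                  lslope (edge_fun G f e) (real_of_ereal (len G e)))
            - (\<Sum>e\<in>{e \<in> edges G. tgt G e = v \<and> len G e = \<infinity>}. end_slope (edge_fun G f e)))"

definition lin_equiv :: "('v, 'e) metric_graph \<Rightarrow> (('v, 'e) point \<Rightarrow> int) \<Rightarrow> (('v, 'e) point \<Rightarrow> int) \<Rightarrow> bool" where
  "lin_equiv G D D' \<longleftrightarrow> (\<exists>f. rational_fun G f \<and> (\<forall>x\<in>pts G. of_int (D x - D' x) = ord G f x))"

definition RR :: "('v, 'e) metric_graph \<Rightarrow> (('v, 'e) point \<Rightarrow> int) \<Rightarrow> (('v, 'e) point \<Rightarrow> ereal) set" where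
  "RR G D = {f. rational_fun G f \<and> (\<forall>x\<in>pts G. of_int (D x) + ord G f x \<ge> 0)}"

definition smult_div :: "int \<Rightarrow> (('v, 'e) point \<Rightarrow> int) \<Rightarrow> ('v, 'e) point \<Rightarrow> int" where
  "smult_div m D = (\<lambda>x. m * D x)"

text \<open>Finite generation of the graded semiring (direct sum over m of R(G, mD)) over
  R^trop.  A homogeneous element of degree m is a function in R(G, mD).  Generators are
  finitely many homogeneous elements (degree, function).  A term is c \<odot> (product of a
  list of generators), of degree the sum of generator degrees; an element of degree m
  must be a nonempty tropical sum (pointwise max) of terms of degree m.  Equality is
  checked at the finite points (values at the points at infinity are determined by
  continuity).\<close>
definition fin_gen_section_ring :: "('v, 'e) metric_graph \<Rightarrow> (('v, 'e) point \<Rightarrow> int) \<Rightarrow> bool" where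
  "fin_gen_section_ring G D \<longleftrightarrow>
     (\<exists>S :: (nat \<times> (('v, 'e) point \<Rightarrow> ereal)) set.
        finite S \<and> (\<forall>(k, h) \<in> S. h \<in> RR G (smult_div (int k) D)) \<and>
        (\<forall>m::nat. \<forall>f \<in> RR G (smult_div (int m) D).
           \<exists>ts :: (real \<times> (nat \<times> (('v, 'e) point \<Rightarrow> ereal)) list) list.
             ts \<noteq> [] \<and>
             (\<forall>(c, gs) \<in> set ts. set gs \<subseteq> S \<and> sum_list (map fst gs) = m) \<and>
             (\<forall>x\<in>fin_pts G. f x = Max (set (map (\<lambda>(c, gs). ereal c + sum_list (map (\<lambda>(k, h). h x) gs)) ts)))))"

end

theory Submission
  imports Defs
begin

text \<open>
  Write p, q for the endpoints of e and N = nd/2. For large m there is a section f of degree mn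
  whose divisor has, in the interior of e, all its chips in one point x, and no chip that would stop
  a chip-firing move from travelling from one side of x to the other: up to the function realising
  the linear equivalence, f has slope -mN on e between p and x and slope mN - c between x and q,
  with c at least 1 independent of m, and f is essentially constant outside e. These points x are
  pairwise distinct as m varies, so for some m the point x is not a breakpoint on e of any of
  finitely many given generators. A term (a product of generators up to a constant) below f that
  agrees with f to the right of x is then linear near x, hence strictly below f to the left of x.
  But where the difference F of the term and f attains its maximum 0 and the divisor of f has no
  chip, all slopes of F vanish; so the zero set of F spreads from x along e to q, from there to p
  through the graph (e is not a bridge), and along e back to the left of x, a contradiction.

  The c remaining chips are placed so that they do not obstruct this. Removing e and q from the
  graph, let W be the part not connected to p. If some half-edge other than those of e leads from q
  into W or back to q, then c is the number of these half-edges, and each of them carries one chip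
  at distance 1/4 from q. Otherwise c = 1 and the chip stays at q; there are then at least two
  half-edges from q towards p, and one chip can stop only one of them because slopes are integers.
\<close>

section \<open>Piecewise linear functions on an interval\<close>

text \<open>Unlike the list of breakpoints in \<^const>\<open>pw_linear\<close>, the set B may be enlarged freely, which
  makes sums and simultaneous treatment of several functions easy.\<close>

definition PL_off :: "real set \<Rightarrow> (real \<Rightarrow> real) \<Rightarrow> ereal \<Rightarrow> bool" where
  "PL_off B g L \<longleftrightarrow> (\<forall>a b. 0 \<le> a \<longrightarrow> a < b \<longrightarrow> ereal b \<le> L \<longrightarrow> B \<inter> {a<..<b} = {} \<longrightarrow>
     (\<exists>s::int. \<forall>t\<in>{a..b}. g t = g a + of_int s * (t - a)))"

lemma PL_offD:
  assumes "PL_off B g L" "0 \<le> a" "a < b" "ereal b \<le> L" "B \<inter> {a<..<b} = {}"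
  obtains s :: int where "\<And>t. a \<le> t \<Longrightarrow> t \<le> b \<Longrightarrow> g t = g a + of_int s * (t - a)"
  using assms unfolding PL_off_def by (meson atLeastAtMost_iff)

lemma PL_off_mono: "PL_off B g L \<Longrightarrow> B \<subseteq> C \<Longrightarrow> PL_off C g L"
  unfolding PL_off_def by (metis (no_types, lifting) Int_mono order_refl subset_empty)

text \<open>Both functions are linear wherever the union of the two exceptional sets is avoided.
  Integer coefficients keep the slopes integral.\<close>

lemma PL_off_lin:
  fixes i j :: int
  assumes g: "PL_off B g L" and h: "PL_off C h L"
    and eq: "\<And>t. 0 \<le> t \<Longrightarrow> ereal t \<le> L \<Longrightarrow> k t = of_int i * g t + of_int j * h t"
  shows "PL_off (B \<union> C) k L"
  unfolding PL_off_def
proof (intro allI impI)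
  fix a b :: real
  assume a: "0 \<le> a" "a < b" "ereal b \<le> L" "(B \<union> C) \<inter> {a<..<b} = {}"
  obtain s where s: "\<And>t. a \<le> t \<Longrightarrow> t \<le> b \<Longrightarrow> g t = g a + of_int s * (t - a)"
    using PL_offD[OF g a(1-3)] a(4) by blast
  obtain s' where s': "\<And>t. a \<le> t \<Longrightarrow> t \<le> b \<Longrightarrow> h t = h a + of_int s' * (t - a)"
    using PL_offD[OF h a(1-3)] a(4) by blast
  have le: "ereal t \<le> L" if "t \<le> b" for t
    using a(3) that order_trans ereal_less_eq(3) by blast
  show "\<exists>s::int. \<forall>t\<in>{a..b}. k t = k a + of_int s * (t - a)"
  proof (intro exI[of _ "i * s + j * s'"] ballI)
    fix t assume t: "t \<in> {a..b}"
    have k: "k t = of_int i * g t + of_int j * h t" "k a = of_int i * g a + of_int j * h a"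
      using a(1,2) t le by (auto intro!: eq)
    have gh: "g t = g a + of_int s * (t - a)" "h t = h a + of_int s' * (t - a)"
      using s[of t] s'[of t] t by auto
    show "k t = k a + of_int (i * s + j * s') * (t - a)"
      unfolding k gh by (simp add: algebra_simps)
  qed
qed

lemma PL_off_cong:
  assumes "PL_off B g L" "\<And>t. 0 \<le> t \<Longrightarrow> ereal t \<le> L \<Longrightarrow> h t = g t"
  shows "PL_off B h L"
  using PL_off_lin[OF assms(1,1), of h 1 0] assms(2) by simp

lemma PL_off_const: "PL_off B (\<lambda>t. k) L"
  unfolding PL_off_def by (auto intro: exI[of _ 0])

text \<open>The breakpoints themselves serve as exceptional set: an interval with none of them in
  its interior lies in a single piece, or beyond the last breakpoint if \<open>L\<close> is
  infinite.\<close>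

lemma pw_linear_imp_PL_off:
  assumes "pw_linear g L"
  shows "\<exists>B. finite B \<and> PL_off B g L"
proof -
  obtain bs :: "real list" where bs: "bs \<noteq> []" "sorted_wrt (<) bs" "hd bs = 0"
      "L \<noteq> \<infinity> \<Longrightarrow> ereal (last bs) = L"
    and lin: "\<And>i. i < length bs - 1 \<Longrightarrow> \<exists>s::int. \<forall>t\<in>{bs ! i .. bs ! (i + 1)}.
         g t = g (bs ! i) + of_int s * (t - bs ! i)"
    and inf: "L = \<infinity> \<Longrightarrow> \<exists>s::int. \<forall>t \<ge> last bs. g t = g (last bs) + of_int s * (t - last bs)"
    using assms unfolding pw_linear_def by blast
  have "PL_off (set bs) g L"
    unfolding PL_off_def
  proof (intro allI impI)
    fix a b :: real
    assume a: "0 \<le> a" "a < b" "ereal b \<le> L" "set bs \<inter> {a<..<b} = {}"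
    have *: "\<exists>s::int. \<forall>t\<in>{a..b}. g t = g a + of_int s * (t - a)"
      if "u \<le> a" "\<forall>t\<in>{a..b}. g t = g u + of_int s * (t - u)" for u and s :: int
    proof (intro exI[of _ s] ballI)
      fix t assume "t \<in> {a..b}"
      then have "g t = g u + of_int s * (t - u)" "g a = g u + of_int s * (a - u)"
        using that(2) a(2) by auto
      then show "g t = g a + of_int s * (t - a)"
        by (simp add: algebra_simps)
    qed
    show "\<exists>s::int. \<forall>t\<in>{a..b}. g t = g a + of_int s * (t - a)"
    proof (cases "last bs \<le> a")
      case True
      \<comment> \<open>For finite \<open>L\<close> the last breakpoint is \<open>L\<close> itself,
        and no interval fits beyond it.\<close>
      have "L = \<infinity>"
        using bs(4) True a(2,3) by (metis ereal_less_eq(3) leD order_trans)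
      with inf obtain s :: int where "\<forall>t \<ge> last bs. g t = g (last bs) + of_int s * (t - last bs)"
        by blast
      then have "\<forall>t\<in>{a..b}. g t = g (last bs) + of_int s * (t - last bs)"
        using True by (meson atLeastAtMost_iff order_trans)
      then show ?thesis by (rule *[OF True])
    next
      case False
      \<comment> \<open>The piece containing the interval starts at the last breakpoint that is not
        beyond \<open>a\<close>.\<close>
      define i where "i = Max {i. i < length bs \<and> bs ! i \<le> a}"
      have "bs ! 0 \<le> a" using bs(1,3) a(1) by (simp add: hd_conv_nth)
      then have "{i. i < length bs \<and> bs ! i \<le> a} \<noteq> {}" using bs(1) by blast
      then have i: "i < length bs" "bs ! i \<le> a"
        unfolding i_def using Max_in[of "{i. i < length bs \<and> bs ! i \<le> a}"] by auto
      have "i \<noteq> length bs - 1" using i(2) False bs(1) by (auto simp: last_conv_nth)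
      then have i1: "i < length bs - 1" using i(1) by linarith
      have "bs ! (i + 1) > a"
      proof (rule ccontr)
        assume "\<not> ?thesis"
        then have "i + 1 \<le> i"
          unfolding i_def by (intro Max_ge) (use i1 i_def in auto)
        then show False by simp
      qed
      then have "b \<le> bs ! (i + 1)"
        using a(4) i1 nth_mem[of "i+1" bs] by force
      moreover from lin[OF i1] obtain s :: int
        where "\<forall>t\<in>{bs ! i .. bs ! (i + 1)}. g t = g (bs ! i) + of_int s * (t - bs ! i)"
        by blast
      ultimately have "\<forall>t\<in>{a..b}. g t = g (bs ! i) + of_int s * (t - bs ! i)"
        using i(2) by (meson atLeastAtMost_iff order_trans)
      then show ?thesis by (rule *[OF i(2)])
    qed
  qed
  then show ?thesis by blast
qed

text \<open>This direction certifies that a constructed function is rational. The list enumerates 0,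
  the end of a finite edge and those elements of \<open>B\<close> that lie strictly inside; the
  remaining elements of \<open>B\<close> are dropped.\<close>

lemma PL_off_imp_pw_linear:
  assumes B: "finite B" and g: "PL_off B g L" and L: "0 < L"
  shows "pw_linear g L"
proof -
  define A where "A = insert 0 ((if L = \<infinity> then {} else {real_of_ereal L}) \<union> {t \<in> B. 0 < t \<and> ereal t < L})"
  define bs where "bs = sorted_list_of_set A"
  have fin: "finite A" using B by (simp add: A_def)
  have set: "set bs = A" and srt: "sorted_wrt (<) bs"
    unfolding bs_def using fin by auto
  have ne: "bs \<noteq> []" using set by (auto simp: A_def)
  have nonneg: "t \<ge> 0" if "t \<in> A" for t
    using that L by (auto simp: A_def real_of_ereal_pos split: if_splits)
  have le: "ereal t \<le> L" if "t \<in> A" for t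
    using that L by (cases L) (auto simp: A_def zero_ereal_def split: if_splits)
  have mono: "bs ! i < bs ! j" if "i < j" "j < length bs" for i j
    using srt that sorted_wrt_nth_less by blast
  have ex_nth: "\<exists>j<length bs. bs ! j = t" if "t \<in> A" for t
    using that unfolding set[symmetric] in_set_conv_nth by blast
  have hd0: "hd bs = 0"
  proof -
    obtain j where j: "j < length bs" "bs ! j = 0"
      using ex_nth[of 0] by (auto simp: A_def)
    have "bs ! 0 \<ge> 0" using nonneg[of "bs ! 0"] ne by (simp flip: set)
    then have "j = 0" using mono[of 0 j] j by fastforce
    then show ?thesis using j ne by (simp add: hd_conv_nth)
  qed
  have last: "t \<le> last bs" if t: "t \<in> A" for t
  proof -
    obtain j where j: "j < length bs" "bs ! j = t" using ex_nth[OF t] by blast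
    then have "j = length bs - 1 \<or> t < bs ! (length bs - 1)"
      using mono[of j "length bs - 1"] ne by fastforce
    then show ?thesis using ne j by (auto simp: last_conv_nth)
  qed
  have lastL: "ereal (last bs) = L" if "L \<noteq> \<infinity>"
  proof -
    have "real_of_ereal L \<in> A" using that by (simp add: A_def)
    moreover have "last bs \<in> A" using ne set by auto
    ultimately show ?thesis
      using last[of "real_of_ereal L"] le[of "last bs"] L that by (cases L) auto
  qed
  have B_A: "t \<in> A" if "t \<in> B" "0 < t" "ereal t < L" for t
    using that by (simp add: A_def)
  show ?thesis
    unfolding pw_linear_def
  proof (intro exI[of _ bs] conjI allI impI)
    fix i assume i: "i < length bs - 1"
    have in_A: "bs ! i \<in> A" "bs ! (i+1) \<in> A" using i by (auto simp flip: set)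
    have "B \<inter> {bs ! i <..< bs ! (i+1)} = {}"
    proof (rule ccontr)
      assume "\<not> ?thesis"
      then obtain t where t: "t \<in> B" "bs ! i < t" "t < bs ! (i+1)" by auto
      have "t \<in> A"
        using t nonneg[OF in_A(1)] le[OF in_A(2)]
        by (intro B_A) (auto intro: less_le_trans[of "ereal t" "ereal (bs ! (i+1))"])
      then obtain j where "j < length bs" "bs ! j = t" using ex_nth by blast
      then show False using t mono[of "i+1" j] mono[of j i] i
        by (cases "j < i"; cases "j = i"; cases "j = i + 1") force+
    qed
    moreover have "bs ! i < bs ! (i+1)" using i by (intro mono) auto
    ultimately obtain s :: int where "\<And>t. bs ! i \<le> t \<Longrightarrow> t \<le> bs ! (i+1) \<Longrightarrow> g t = g (bs ! i) + of_int s * (t - bs ! i)"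
      using PL_offD[OF g nonneg[OF in_A(1)] _ le[OF in_A(2)]] by blast
    then show "\<exists>s::int. \<forall>t\<in>{bs ! i .. bs ! (i + 1)}. g t = g (bs ! i) + of_int s * (t - bs ! i)"
      by (meson atLeastAtMost_iff)
  next
    assume inf: "L = \<infinity>"
    define u where "u = last bs"
    have u: "0 \<le> u" using nonneg[of u] ne set by (auto simp: u_def)
    have none: "B \<inter> {u<..<b} = {}" for b
    proof (rule ccontr)
      assume "\<not> ?thesis"
      then obtain t where t: "t \<in> B" "u < t" by auto
      then have "t \<in> A" using u inf by (intro B_A) auto
      then show False using last[of t] t by (simp add: u_def)
    qed
    obtain s :: int where s: "\<And>t. u \<le> t \<Longrightarrow> t \<le> u+1 \<Longrightarrow> g t = g u + of_int s * (t - u)"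
      using PL_offD[OF g u _ _ none, of "u+1"] inf by (metis ereal_less_eq(1) less_add_one)
    have "g t = g u + of_int s * (t - u)" if t: "t \<ge> u" for t
    proof -
      \<comment> \<open>Each bounded interval comes with a slope of its own; comparing the values at
        \<open>u + 1\<close> shows that all these slopes agree.\<close>
      obtain s' :: int where s': "\<And>r. u \<le> r \<Longrightarrow> r \<le> max t (u+1) \<Longrightarrow> g r = g u + of_int s' * (r - u)"
        using PL_offD[OF g u _ _ none, of "max t (u+1)"] inf
        by (metis ereal_less_eq(1) less_add_one less_max_iff_disj)
      have "s = s'" using s[of "u+1"] s'[of "u+1"] by simp
      then show ?thesis using s'[of t] t by simp
    qed
    then show "\<exists>s::int. \<forall>t\<ge>last bs. g t = g (last bs) + of_int s * (t - last bs)"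
      unfolding u_def by blast
  qed (use ne srt hd0 lastL in auto)
qed

section \<open>Linear germs and one-sided slopes\<close>

text \<open>A germ records at once that a slope exists and what it is, whereas
  \<open>rslope\<close>, \<open>lslope\<close> and \<open>end_slope\<close> are definite
  descriptions, which say nothing without existence. Slopes are taken along increasing
  \<open>t\<close> on both sides, so the outgoing slope belonging to a left germ is
  \<open>- s\<close>.\<close>

definition rgerm :: "(real \<Rightarrow> real) \<Rightarrow> real \<Rightarrow> real \<Rightarrow> bool" where
  "rgerm g t s \<longleftrightarrow> (\<exists>d>0. \<forall>u\<in>{t..t+d}. g u = g t + s * (u - t))"

definition lgerm :: "(real \<Rightarrow> real) \<Rightarrow> real \<Rightarrow> real \<Rightarrow> bool" where
  "lgerm g t s \<longleftrightarrow> (\<exists>d>0. \<forall>u\<in>{t-d..t}. g u = g t + s * (u - t))"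

definition egerm :: "(real \<Rightarrow> real) \<Rightarrow> real \<Rightarrow> bool" where
  "egerm g s \<longleftrightarrow> (\<exists>T. \<forall>t\<ge>T. g t = g T + s * (t - T))"

lemma rgermE:
  assumes "rgerm g t s" "0 < b"
  obtains d where "0 < d" "d \<le> b" "\<And>u. t \<le> u \<Longrightarrow> u \<le> t + d \<Longrightarrow> g u = g t + s * (u - t)"
proof -
  obtain d where "d > 0" "\<forall>u\<in>{t..t+d}. g u = g t + s * (u - t)"
    using assms(1) unfolding rgerm_def by blast
  moreover have "u \<in> {t..t+d}" if "t \<le> u" "u \<le> t + min d b" for u
    using that by simp
  ultimately have *: "g u = g t + s * (u - t)" if "t \<le> u" "u \<le> t + min d b" for u
    using that by blast
  then show ?thesis using assms(2) \<open>d > 0\<close> by (intro that[OF _ _ *]) simp_all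
qed

lemma lgermE:
  assumes "lgerm g t s" "0 < b"
  obtains d where "0 < d" "d \<le> b" "\<And>u. t - d \<le> u \<Longrightarrow> u \<le> t \<Longrightarrow> g u = g t + s * (u - t)"
proof -
  obtain d where "d > 0" "\<forall>u\<in>{t-d..t}. g u = g t + s * (u - t)"
    using assms(1) unfolding lgerm_def by blast
  moreover have "u \<in> {t-d..t}" if "t - min d b \<le> u" "u \<le> t" for u
    using that by simp
  ultimately have *: "g u = g t + s * (u - t)" if "t - min d b \<le> u" "u \<le> t" for u
    using that by blast
  then show ?thesis using assms(2) \<open>d > 0\<close> by (intro that[OF _ _ *]) simp_all
qed

lemma rgermI: "0 < d \<Longrightarrow> (\<And>u. t \<le> u \<Longrightarrow> u \<le> t + d \<Longrightarrow> g u = g t + s * (u - t)) \<Longrightarrow> rgerm g t s"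
  unfolding rgerm_def by (meson atLeastAtMost_iff)

lemma lgermI: "0 < d \<Longrightarrow> (\<And>u. t - d \<le> u \<Longrightarrow> u \<le> t \<Longrightarrow> g u = g t + s * (u - t)) \<Longrightarrow> lgerm g t s"
  unfolding lgerm_def by (meson atLeastAtMost_iff)

lemma rslope_eq:
  assumes "rgerm g t s" shows "rslope g t = s"
proof -
  obtain d where d: "0 < d" "\<And>u. t \<le> u \<Longrightarrow> u \<le> t + d \<Longrightarrow> g u = g t + s * (u - t)"
    using rgermE[OF assms zero_less_one] by metis
  have *: "(g has_real_derivative s) (at t within {t..})"
  proof (rule has_field_derivative_transform_within[OF _ d(1)])
    show "((\<lambda>u. g t + s * (u - t)) has_real_derivative s) (at t within {t..})"
      by (auto intro!: derivative_eq_intros)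
    show "g t + s * (u - t) = g u" if "u \<in> {t..}" "dist u t < d" for u
      using d(2)[of u] that by (simp add: dist_real_def)
  qed simp
  have nb: "at t within {t..} \<noteq> bot"
    by (simp add: at_within_Ici_at_right)
  show ?thesis
    unfolding rslope_def
  proof (rule the_equality)
    show "(g has_real_derivative s) (at t within {t..})" by (rule *)
    fix s' assume "(g has_real_derivative s') (at t within {t..})"
    then show "s' = s"
      using * nb unfolding has_field_derivative_iff
      by (metis tendsto_unique)
  qed
qed

lemma lslope_eq:
  assumes "lgerm g t s" shows "lslope g t = s"
proof -
  obtain d where d: "0 < d" "\<And>u. t - d \<le> u \<Longrightarrow> u \<le> t \<Longrightarrow> g u = g t + s * (u - t)"
    using lgermE[OF assms zero_less_one] by metis
  have *: "(g has_real_derivative s) (at t within {..t})"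
  proof (rule has_field_derivative_transform_within[OF _ d(1)])
    show "((\<lambda>u. g t + s * (u - t)) has_real_derivative s) (at t within {..t})"
      by (auto intro!: derivative_eq_intros)
    show "g t + s * (u - t) = g u" if "u \<in> {..t}" "dist u t < d" for u
      using d(2)[of u] that by (simp add: dist_real_def)
  qed simp
  have nb: "at t within {..t} \<noteq> bot"
    by (simp add: at_within_Iic_at_left)
  show ?thesis
    unfolding lslope_def
  proof (rule the_equality)
    show "(g has_real_derivative s) (at t within {..t})" by (rule *)
    fix s' assume "(g has_real_derivative s') (at t within {..t})"
    then show "s' = s"
      using * nb unfolding has_field_derivative_iff
      by (metis tendsto_unique)
  qed
qed

lemma end_slope_eq:
  assumes "egerm g s" shows "end_slope g = s"
  unfolding end_slope_def
proof (rule the_equality)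
  show "\<exists>T. \<forall>t\<ge>T. g t = g T + s * (t - T)" using assms by (simp add: egerm_def)
next
  fix s' assume "\<exists>T. \<forall>t\<ge>T. g t = g T + s' * (t - T)"
  then obtain T' where T': "\<And>t. t \<ge> T' \<Longrightarrow> g t = g T' + s' * (t - T')" by blast
  obtain T where T: "\<And>t. t \<ge> T \<Longrightarrow> g t = g T + s * (t - T)"
    using assms unfolding egerm_def by blast
  define u where "u = max T T'"
  have u: "T \<le> u" "T' \<le> u" by (auto simp: u_def)
  show "s' = s"
    using T[of u] T'[of u] T[of "u+1"] T'[of "u+1"] u by (simp add: algebra_simps)
qed

text \<open>The relation is asked for only on a segment of length \<open>b\<close>, because the
  values of \<open>edge_fun\<close> beyond the end of an edge are not controlled.\<close>

lemma rgerm_lin: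
  assumes "rgerm g t s" "rgerm h t s'" "0 < b"
    and eq: "\<And>u. t \<le> u \<Longrightarrow> u \<le> t + b \<Longrightarrow> k u = i * g u + j * h u"
  shows "rgerm k t (i * s + j * s')"
proof -
  obtain d where d: "0 < d" "d \<le> b" "\<And>u. t \<le> u \<Longrightarrow> u \<le> t + d \<Longrightarrow> g u = g t + s * (u - t)"
    using rgermE[OF assms(1,3)] by metis
  obtain d' where d': "0 < d'" "d' \<le> b" "\<And>u. t \<le> u \<Longrightarrow> u \<le> t + d' \<Longrightarrow> h u = h t + s' * (u - t)"
    using rgermE[OF assms(2,3)] by metis
  show ?thesis
  proof (rule rgermI[of "min d d'"])
    fix u assume u: "t \<le> u" "u \<le> t + min d d'"
    have k: "k u = i * g u + j * h u" "k t = i * g t + j * h t" using u d(2) assms(3) by (auto intro!: eq)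
    have gh: "g u = g t + s * (u - t)" "h u = h t + s' * (u - t)"
      using u by (auto intro!: d(3) d'(3))
    show "k u = k t + (i * s + j * s') * (u - t)" unfolding k gh by (simp add: algebra_simps)
  qed (use d d' in auto)
qed

lemma lgerm_lin:
  assumes "lgerm g t s" "lgerm h t s'" "0 < b"
    and eq: "\<And>u. t - b \<le> u \<Longrightarrow> u \<le> t \<Longrightarrow> k u = i * g u + j * h u"
  shows "lgerm k t (i * s + j * s')"
proof -
  obtain d where d: "0 < d" "d \<le> b" "\<And>u. t - d \<le> u \<Longrightarrow> u \<le> t \<Longrightarrow> g u = g t + s * (u - t)"
    using lgermE[OF assms(1,3)] by metis
  obtain d' where d': "0 < d'" "d' \<le> b" "\<And>u. t - d' \<le> u \<Longrightarrow> u \<le> t \<Longrightarrow> h u = h t + s' * (u - t)"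
    using lgermE[OF assms(2,3)] by metis
  show ?thesis
  proof (rule lgermI[of "min d d'"])
    fix u assume u: "t - min d d' \<le> u" "u \<le> t"
    have k: "k u = i * g u + j * h u" "k t = i * g t + j * h t" using u d(2) assms(3) by (auto intro!: eq)
    have gh: "g u = g t + s * (u - t)" "h u = h t + s' * (u - t)"
      using u by (auto intro!: d(3) d'(3))
    show "k u = k t + (i * s + j * s') * (u - t)" unfolding k gh by (simp add: algebra_simps)
  qed (use d d' in auto)
qed

lemma egerm_lin:
  assumes "egerm g s" "egerm h s'"
    and eq: "\<And>u. 0 \<le> u \<Longrightarrow> k u = i * g u + j * h u"
  shows "egerm k (i * s + j * s')"
proof -
  obtain T where T: "\<And>t. t \<ge> T \<Longrightarrow> g t = g T + s * (t - T)"
    using assms(1) unfolding egerm_def by blast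
  obtain T' where T': "\<And>t. t \<ge> T' \<Longrightarrow> h t = h T' + s' * (t - T')"
    using assms(2) unfolding egerm_def by blast
  define u where "u = max 0 (max T T')"
  have "k t = k u + (i * s + j * s') * (t - u)" if "t \<ge> u" for t
  proof -
    have k: "k t = i * g t + j * h t" "k u = i * g u + j * h u" using that by (auto intro!: eq simp: u_def)
    have g: "g t = g T + s * (t - T)" "g u = g T + s * (u - T)"
      and h: "h t = h T' + s' * (t - T')" "h u = h T' + s' * (u - T')"
      using that by (auto intro!: T T' simp: u_def)
    show ?thesis unfolding k g h by (simp add: algebra_simps)
  qed
  then show ?thesis unfolding egerm_def by blast
qed

lemma finite_gap:
  fixes B :: "real set"
  assumes "finite B" shows "\<exists>d>0. \<forall>x\<in>B. x \<noteq> t \<longrightarrow> d \<le> \<bar>x - t\<bar>"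
  using assms
proof (induction B rule: finite_induct)
  case empty
  show ?case by (auto intro: exI[of _ 1])
next
  case (insert y B)
  then obtain d where d: "d > 0" "\<forall>x\<in>B. x \<noteq> t \<longrightarrow> d \<le> \<bar>x - t\<bar>" by blast
  show ?case
  proof (cases "y = t")
    case False
    then show ?thesis using d by (intro exI[of _ "min d \<bar>y - t\<bar>"]) auto
  qed (use d in auto)
qed

lemma PL_off_rgerm:
  assumes "finite B" "PL_off B g L" "0 \<le> t" "ereal t < L"
  shows "\<exists>s::int. rgerm g t (of_int s)"
proof -
  obtain d where d: "d > 0" "\<forall>x\<in>B. x \<noteq> t \<longrightarrow> d \<le> \<bar>x - t\<bar>" using finite_gap[OF assms(1)] by blast
  obtain u where u: "t < u" "ereal u \<le> L"
    using assms(4) by (cases L) (auto intro: that[of "t+1"])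
  have "B \<inter> {t<..<min u (t + d)} = {}" using d by force
  moreover have "ereal (min u (t+d)) \<le> L" using u(2) by (meson ereal_less_eq(3) min.cobounded1 order_trans)
  ultimately obtain s :: int
    where s: "\<And>r. t \<le> r \<Longrightarrow> r \<le> min u (t+d) \<Longrightarrow> g r = g t + of_int s * (r - t)"
    using PL_offD[OF assms(2,3), of "min u (t+d)"] u(1) d(1) by (metis less_add_same_cancel1 min_less_iff_conj)
  have "rgerm g t (of_int s)"
  proof (rule rgermI)
    show "0 < min u (t+d) - t" using u d by simp
    show "g r = g t + of_int s * (r - t)" if "t \<le> r" "r \<le> t + (min u (t+d) - t)" for r
      using s[of r] that by simp
  qed
  then show ?thesis by blast
qed

lemma PL_off_lgerm:
  assumes "finite B" "PL_off B g L" "0 < t" "ereal t \<le> L"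
  shows "\<exists>s::int. lgerm g t (of_int s)"
proof -
  obtain d where d: "d > 0" "\<forall>x\<in>B. x \<noteq> t \<longrightarrow> d \<le> \<bar>x - t\<bar>" using finite_gap[OF assms(1)] by blast
  define a where "a = max 0 (t - d)"
  have a: "0 \<le> a" "a < t" using assms(3) d by (auto simp: a_def)
  have "B \<inter> {a<..<t} = {}" using d by (force simp: a_def)
  then obtain s :: int where s: "\<And>r. a \<le> r \<Longrightarrow> r \<le> t \<Longrightarrow> g r = g a + of_int s * (r - a)"
    using PL_offD[OF assms(2) a assms(4)] by blast
  show ?thesis
  proof (intro exI[of _ s] lgermI[of "t - a"])
    fix u assume "t - (t - a) \<le> u" "u \<le> t"
    then show "g u = g t + of_int s * (u - t)"
      using s[of u] s[of t] a by (simp add: algebra_simps)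
  qed (use a in simp)
qed

lemma PL_off_egerm:
  assumes "finite B" "PL_off B g \<infinity>"
  shows "\<exists>s::int. egerm g (of_int s)"
proof -
  have "finite (insert 0 B)" using assms(1) by simp
  then obtain u where u: "\<forall>x\<in>insert 0 B. x \<le> u" by (meson Max_ge)
  then have 0: "0 \<le> u" and none: "B \<inter> {u<..<b} = {}" for b by force+
  obtain s :: int where s: "\<And>t. u \<le> t \<Longrightarrow> t \<le> u+1 \<Longrightarrow> g t = g u + of_int s * (t - u)"
    using PL_offD[OF assms(2) 0 _ _ none, of "u+1"] by (metis ereal_less_eq(1) less_add_one)
  have "g t = g u + of_int s * (t - u)" if t: "t \<ge> u" for t
  proof -
    obtain s' :: int where s': "\<And>r. u \<le> r \<Longrightarrow> r \<le> max t (u+1) \<Longrightarrow> g r = g u + of_int s' * (r - u)"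
      using PL_offD[OF assms(2) 0 _ _ none, of "max t (u+1)"]
      by (metis ereal_less_eq(1) less_add_one less_max_iff_disj)
    have "s = s'" using s[of "u+1"] s'[of "u+1"] by simp
    then show ?thesis using s'[of t] t by simp
  qed
  then show ?thesis unfolding egerm_def by blast
qed

section \<open>Zero sets of nonpositive functions on an interval\<close>

text \<open>Let \<open>z\<close> be the end of the initial stretch of zeros. The left slope at
  \<open>z\<close> is 0, so \<open>kink\<close> makes the right slope nonnegative, while
  \<open>g\<close> being nonpositive makes it nonpositive. Hence the zeros continue past
  \<open>z\<close> unless \<open>z = b\<close>.\<close>

lemma zero_spreads_right:
  fixes g :: "real \<Rightarrow> real"
  assumes ab: "a < b" and start: "rgerm g a 0" "g a = 0"
    and rg: "\<And>t. a < t \<Longrightarrow> t < b \<Longrightarrow> \<exists>s. rgerm g t s"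
    and lg: "\<And>t. a < t \<Longrightarrow> t \<le> b \<Longrightarrow> \<exists>s. lgerm g t s"
    and le: "\<And>t. a \<le> t \<Longrightarrow> t \<le> b \<Longrightarrow> g t \<le> 0"
    and kink: "\<And>t r l. a < t \<Longrightarrow> t < b \<Longrightarrow> rgerm g t r \<Longrightarrow> lgerm g t l \<Longrightarrow> l \<le> r"
    and t: "a \<le> t" "t \<le> b"
  shows "g t = 0"
proof -
  define Z where "Z = {u. a \<le> u \<and> u \<le> b \<and> (\<forall>r\<in>{a..u}. g r = 0)}"
  define z where "z = Sup Z"
  have bdd: "bdd_above Z" by (auto simp: Z_def bdd_above_def)
  obtain d where d: "0 < d" "d \<le> b - a" "\<And>u. a \<le> u \<Longrightarrow> u \<le> a + d \<Longrightarrow> g u = g a + 0 * (u - a)"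
    using rgermE[OF start(1), of "b - a"] ab by (metis diff_gt_0_iff_gt)
  have "g u = 0" if "a \<le> u" "u \<le> a + d" for u using d(3)[OF that] start(2) by simp
  then have "a + d \<in> Z" using d(1,2) by (auto simp: Z_def)
  then have zd: "a + d \<le> z" and ne: "Z \<noteq> {}" unfolding z_def using bdd by (auto intro: cSup_upper)
  have zb: "z \<le> b" unfolding z_def using ne by (intro cSup_least) (auto simp: Z_def)
  have below: "g r = 0" if "a \<le> r" "r < z" for r
    using less_cSupD[OF ne that(2)[unfolded z_def]] that(1) by (auto simp: Z_def)
  obtain l where l: "lgerm g z l" using lg[of z] zd d(1) zb by auto
  obtain e where e: "0 < e" "e \<le> z - a" "\<And>u. z - e \<le> u \<Longrightarrow> u \<le> z \<Longrightarrow> g u = g z + l * (u - z)"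
    using lgermE[OF l, of "z - a"] zd d(1) by (metis add_le_cancel_left diff_gt_0_iff_gt less_add_same_cancel1 less_le_trans)
  \<comment> \<open>Zeros at two different points of the left germ determine both its slope and its
    value at \<open>z\<close>; this replaces an appeal to continuity.\<close>
  have "g z + l * (- e) = 0" "g z + l * (- (e/2)) = 0"
    using e(3)[of "z - e"] e(3)[of "z - e/2"] below[of "z - e"] below[of "z - e/2"] e(1,2) by auto
  then have "l * e = 0" "g z = 0" by (auto simp: field_simps)
  then have l0: "l = 0" and gz: "g z = 0" using e(1) by auto
  have "z = b"
  proof (rule ccontr)
    assume "z \<noteq> b"
    then have zb': "z < b" using zb by simp
    obtain r where r: "rgerm g z r" using rg[of z] zd d(1) zb' by auto
    then have "0 \<le> r" using kink[of z r l] l l0 zd d(1) zb' by auto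
    obtain f where f: "0 < f" "f \<le> b - z" "\<And>u. z \<le> u \<Longrightarrow> u \<le> z + f \<Longrightarrow> g u = g z + r * (u - z)"
      using rgermE[OF r, of "b - z"] zb' by (metis diff_gt_0_iff_gt)
    have "r * f \<le> 0" using f(3)[of "z+f"] le[of "z+f"] f(1,2) gz zd d(1) by auto
    then have "r = 0" using \<open>0 \<le> r\<close> f(1) by (smt (verit) mult_pos_pos)
    then have "g u = 0" if "a \<le> u" "u \<le> z + f" for u
      using f(3)[of u] gz below[of u] that by (cases "u < z") auto
    then have "z + f \<in> Z" using f(1,2) zd d(1) by (auto simp: Z_def)
    then have "z + f \<le> z" unfolding z_def by (rule cSup_upper[OF _ bdd])
    then show False using f(1) by simp
  qed
  then show ?thesis using below[of t] gz t by (cases "t = z") auto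
qed

lemma rgerm_reflect: "rgerm (\<lambda>t. g (L - t)) t s \<longleftrightarrow> lgerm g (L - t) (- s)"
proof
  assume "rgerm (\<lambda>t. g (L - t)) t s"
  then obtain d where d: "d > 0" "\<And>u. t \<le> u \<Longrightarrow> u \<le> t + d \<Longrightarrow> g (L - u) = g (L - t) + s * (u - t)"
    using rgermE[OF _ zero_less_one] by metis
  show "lgerm g (L - t) (- s)"
  proof (rule lgermI[OF d(1)])
    fix u assume "L - t - d \<le> u" "u \<le> L - t"
    then show "g u = g (L - t) + - s * (u - (L - t))"
      using d(2)[of "L - u"] by (simp add: algebra_simps)
  qed
next
  assume "lgerm g (L - t) (- s)"
  then obtain d where d: "d > 0" "\<And>u. L - t - d \<le> u \<Longrightarrow> u \<le> L - t \<Longrightarrow> g u = g (L - t) + - s * (u - (L - t))"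
    using lgermE[OF _ zero_less_one] by metis
  show "rgerm (\<lambda>t. g (L - t)) t s"
  proof (rule rgermI[OF d(1)])
    fix u assume "t \<le> u" "u \<le> t + d"
    then show "g (L - u) = g (L - t) + s * (u - t)"
      using d(2)[of "L - u"] by (simp add: algebra_simps)
  qed
qed

lemma lgerm_reflect: "lgerm (\<lambda>t. g (L - t)) t s \<longleftrightarrow> rgerm g (L - t) (- s)"
  using rgerm_reflect[of "\<lambda>t. g (L - t)" L "L - t" "- s"] by simp

text \<open>Mirror image under \<open>t\<close> to \<open>b - t\<close>, which exchanges left and
  right germs and changes the sign of slopes.\<close>

lemma zero_spreads_left:
  fixes g :: "real \<Rightarrow> real"
  assumes ab: "a < b" and start: "lgerm g b 0" "g b = 0"
    and rg: "\<And>t. a \<le> t \<Longrightarrow> t < b \<Longrightarrow> \<exists>s. rgerm g t s"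
    and lg: "\<And>t. a < t \<Longrightarrow> t < b \<Longrightarrow> \<exists>s. lgerm g t s"
    and le: "\<And>t. a \<le> t \<Longrightarrow> t \<le> b \<Longrightarrow> g t \<le> 0"
    and kink: "\<And>t r l. a < t \<Longrightarrow> t < b \<Longrightarrow> rgerm g t r \<Longrightarrow> lgerm g t l \<Longrightarrow> l \<le> r"
    and t: "a \<le> t" "t \<le> b"
  shows "g t = 0"
proof -
  let ?h = "\<lambda>t. g (b - t)"
  have "?h (b - t) = 0"
  proof (rule zero_spreads_right[where g = ?h and a = 0 and b = "b - a"])
    show "rgerm ?h 0 0" using start(1) by (simp add: rgerm_reflect)
    show "\<exists>s. rgerm ?h u s" if "0 < u" "u < b - a" for u
      using lg[of "b - u"] that by (auto simp: rgerm_reflect intro: exI[of _ "- _"] )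
    show "\<exists>s. lgerm ?h u s" if "0 < u" "u \<le> b - a" for u
      using rg[of "b - u"] that by (auto simp: lgerm_reflect intro: exI[of _ "- _"])
    show "l \<le> r" if "0 < u" "u < b - a" "rgerm ?h u r" "lgerm ?h u l" for u l r
      using kink[of "b - u" "- l" "- r"] that by (simp add: rgerm_reflect lgerm_reflect)
  qed (use ab start(2) le t in auto)
  then show ?thesis by simp
qed

section \<open>Rational functions on a tropical curve\<close>

text \<open>Only the real-valued restrictions to the edges are kept from
  \<open>rational_fun\<close>. They determine all slopes, and a difference such as a term minus a
  section belongs to this class without any care for infinite values.\<close>

definition PL_fun :: "('v, 'e) metric_graph \<Rightarrow> (('v, 'e) point \<Rightarrow> ereal) \<Rightarrow> bool" where
  "PL_fun G f \<longleftrightarrow> (\<forall>ed\<in>edges G. \<exists>B. finite B \<and> PL_off B (edge_fun G f ed) (len G ed))"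

lemma PL_funE:
  assumes "PL_fun G f" "ed \<in> edges G"
  obtains B where "finite B" "PL_off B (edge_fun G f ed) (len G ed)"
  using assms unfolding PL_fun_def by blast

lemma rational_fun_PL_fun: "rational_fun G f \<Longrightarrow> PL_fun G f"
  unfolding rational_fun_def PL_fun_def using pw_linear_imp_PL_off by blast

lemma PL_fun_rgerm:
  assumes "PL_fun G f" "ed \<in> edges G" "0 \<le> t" "ereal t < len G ed"
  shows "rgerm (edge_fun G f ed) t (rslope (edge_fun G f ed) t)"
  using PL_funE[OF assms(1,2)] PL_off_rgerm[OF _ _ assms(3,4)] rslope_eq by metis

lemma PL_fun_lgerm:
  assumes "PL_fun G f" "ed \<in> edges G" "0 < t" "ereal t \<le> len G ed"
  shows "lgerm (edge_fun G f ed) t (lslope (edge_fun G f ed) t)"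
  using PL_funE[OF assms(1,2)] PL_off_lgerm[OF _ _ assms(3,4)] lslope_eq by metis

lemma PL_fun_egerm:
  assumes "PL_fun G f" "ed \<in> edges G" "len G ed = \<infinity>"
  shows "egerm (edge_fun G f ed) (end_slope (edge_fun G f ed))"
  using PL_funE[OF assms(1,2)] PL_off_egerm assms(3) end_slope_eq by metis

lemma PL_fun_integer_slope:
  assumes "PL_fun G f" "ed \<in> edges G"
  shows "0 \<le> t \<Longrightarrow> ereal t < len G ed \<Longrightarrow> rslope (edge_fun G f ed) t \<in> \<int>"
    and "0 < t \<Longrightarrow> ereal t \<le> len G ed \<Longrightarrow> lslope (edge_fun G f ed) t \<in> \<int>"
proof -
  obtain B where B: "finite B" "PL_off B (edge_fun G f ed) (len G ed)" by (rule PL_funE[OF assms])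
  show "rslope (edge_fun G f ed) t \<in> \<int>" if "0 \<le> t" "ereal t < len G ed"
    using PL_off_rgerm[OF B that] by (auto simp: rslope_eq)
  show "lslope (edge_fun G f ed) t \<in> \<int>" if "0 < t" "ereal t \<le> len G ed"
    using PL_off_lgerm[OF B that] by (auto simp: lslope_eq)
qed

section \<open>Infinite edges, points at finite distance, and additivity of
  \<open>ord\<close>\<close>

text \<open>An infinite end has valence 1, and \<open>e0\<close> already accounts for this one
  half-edge.\<close>

lemma inf_edge_unique:
  assumes G: "tropical_curve G" and e0: "e0 \<in> edges G" "len G e0 = \<infinity>"
    and f: "f \<in> edges G" "src G f = tgt G e0 \<or> tgt G f = tgt G e0"
  shows "f = e0" "src G f \<noteq> tgt G e0"
proof -
  let ?S = "{f \<in> edges G. src G f = tgt G e0}" and ?T = "{f \<in> edges G. tgt G f = tgt G e0}"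
  have fin: "finite ?S" "finite ?T" using G by (auto simp: tropical_curve_def)
  have "card ?S + card ?T = 1" using G e0 by (auto simp: tropical_curve_def valence_def)
  moreover have "e0 \<in> ?T" using e0 by simp
  then have "card ?T \<ge> 1" using fin(2) by (metis One_nat_def Suc_leI card_gt_0_iff empty_iff)
  ultimately have "card ?S = 0" "card ?T = 1" by auto
  then have "?S = {}" and T: "\<exists>x. ?T = {x}" using fin(1) by (auto simp: card_1_singleton_iff)
  moreover have "?T = {e0}" using T \<open>e0 \<in> ?T\<close> by (metis singletonD)
  ultimately have "?S = {}" "?T = {e0}" by auto
  then show "f = e0" "src G f \<noteq> tgt G e0" using f by blast+
qed

lemma src_not_inf_end:
  assumes "tropical_curve G" "f \<in> edges G" shows "\<not> inf_end G (src G f)"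
  using inf_edge_unique[OF assms(1) _ _ assms(2)] unfolding inf_end_def by metis

lemma tgt_inf_end_iff:
  assumes "tropical_curve G" "f \<in> edges G" shows "inf_end G (tgt G f) \<longleftrightarrow> len G f = \<infinity>"
  using inf_edge_unique[OF assms(1) _ _ assms(2)] assms(2) unfolding inf_end_def by metis

lemma tropical_curve_edge:
  assumes "tropical_curve G" "f \<in> edges G"
  shows "src G f \<in> verts G" "tgt G f \<in> verts G" "0 < len G f"
  using assms by (auto simp: tropical_curve_def)

lemma point_at_simps:
  assumes "tropical_curve G" "f \<in> edges G"
  shows "point_at G f 0 = Vx (src G f)"
    and "ereal l = len G f \<Longrightarrow> point_at G f l = Vx (tgt G f)"
    and "0 < t \<Longrightarrow> ereal t < len G f \<Longrightarrow> point_at G f t = Ix f t"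
  using tropical_curve_edge(3)[OF assms] by (auto simp: point_at_def zero_ereal_def)

text \<open>A real parameter never reaches the end of an infinite edge, so computations along an
  edge only meet points where rational functions are finite.\<close>

lemma point_at_fin:
  assumes G: "tropical_curve G" and f: "f \<in> edges G" and t: "0 \<le> t" "ereal t \<le> len G f"
  shows "point_at G f t \<in> fin_pts G"
proof -
  consider "t = 0" | "ereal t = len G f" "t \<noteq> 0" | "0 < t" "ereal t < len G f"
    using t by fastforce
  then show ?thesis
  proof cases
    case 1
    then show ?thesis using G f src_not_inf_end[OF G f] tropical_curve_edge[OF G f]
      by (auto simp: point_at_def fin_pts_def pts_def)
  next
    case 2
    then have "\<not> inf_end G (tgt G f)" using tgt_inf_end_iff[OF G f] by auto
    then show ?thesis using 2 tropical_curve_edge[OF G f]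
      by (auto simp: point_at_def fin_pts_def pts_def)
  next
    case 3
    then show ?thesis using f by (auto simp: point_at_def fin_pts_def pts_def)
  qed
qed

text \<open>\<open>ord\<close> is computed from \<open>edge_fun\<close> alone, even at infinite
  ends. It is therefore enough to know the relation for real parts at the points of
  \<open>fin_pts\<close>, and \<open>h\<close> may be infinite at the ends.\<close>

lemma ord_lin:
  fixes i j :: int
  assumes G: "tropical_curve G" and f: "PL_fun G f" and g: "PL_fun G g"
    and eq: "\<And>x. x \<in> fin_pts G \<Longrightarrow>
      real_of_ereal (h x) = of_int i * real_of_ereal (f x) + of_int j * real_of_ereal (g x)"
  shows "PL_fun G h"
    and "x \<in> pts G \<Longrightarrow> ord G h x = of_int i * ord G f x + of_int j * ord G g x"
proof -
  have efun: "edge_fun G h ed t = of_int i * edge_fun G f ed t + of_int j * edge_fun G g ed t"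
    if "ed \<in> edges G" "0 \<le> t" "ereal t \<le> len G ed" for ed t
    unfolding edge_fun_def using point_at_fin[OF G that] by (rule eq)
  show PLh: "PL_fun G h"
    unfolding PL_fun_def
  proof
    fix ed assume ed: "ed \<in> edges G"
    obtain B where B: "finite B" "PL_off B (edge_fun G f ed) (len G ed)" by (rule PL_funE[OF f ed])
    obtain C where C: "finite C" "PL_off C (edge_fun G g ed) (len G ed)" by (rule PL_funE[OF g ed])
    have "PL_off (B \<union> C) (edge_fun G h ed) (len G ed)"
      by (rule PL_off_lin[OF B(2) C(2) efun[OF ed]])
    then show "\<exists>B. finite B \<and> PL_off B (edge_fun G h ed) (len G ed)" using B(1) C(1) by blast
  qed
  have rs: "rslope (edge_fun G h ed) t = of_int i * rslope (edge_fun G f ed) t + of_int j * rslope (edge_fun G g ed) t"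
    if "ed \<in> edges G" "0 \<le> t" "ereal t < len G ed" for ed t
  proof -
    obtain u where u: "t < u" "ereal u \<le> len G ed"
      using \<open>ereal t < len G ed\<close> by (cases "len G ed") (auto intro: that[of "t+1"])
    have le: "ereal r \<le> len G ed" if "r \<le> u" for r
      using u(2) that by (meson ereal_less_eq(3) order_trans)
    show ?thesis
      by (rule rslope_eq[OF rgerm_lin[OF PL_fun_rgerm[OF f that] PL_fun_rgerm[OF g that], of "u - t"]])
        (use u(1) that le in \<open>auto intro!: efun\<close>)
  qed
  have ls: "lslope (edge_fun G h ed) t = of_int i * lslope (edge_fun G f ed) t + of_int j * lslope (edge_fun G g ed) t"
    if "ed \<in> edges G" "0 < t" "ereal t \<le> len G ed" for ed t
  proof -
    have le: "ereal r \<le> len G ed" if "r \<le> t" for r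
      using \<open>ereal t \<le> len G ed\<close> that by (meson ereal_less_eq(3) order_trans)
    show ?thesis
      by (rule lslope_eq[OF lgerm_lin[OF PL_fun_lgerm[OF f that] PL_fun_lgerm[OF g that], of t]])
        (use that le in \<open>auto intro!: efun\<close>)
  qed
  have es: "end_slope (edge_fun G h ed) = of_int i * end_slope (edge_fun G f ed) + of_int j * end_slope (edge_fun G g ed)"
    if "ed \<in> edges G" "len G ed = \<infinity>" for ed
    by (rule end_slope_eq[OF egerm_lin[OF PL_fun_egerm[OF f that] PL_fun_egerm[OF g that]]])
      (use that in \<open>auto intro!: efun\<close>)
  assume x: "x \<in> pts G"
  show "ord G h x = of_int i * ord G f x + of_int j * ord G g x"
  proof (cases x)
    case (Ix ed t)
    then have "ed \<in> edges G" "0 < t" "ereal t < len G ed" using x by (auto simp: pts_def)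
    then show ?thesis using Ix by (simp add: ord_def rs ls algebra_simps)
  next
    case (Vx v)
    have 1: "(\<Sum>e\<in>{e \<in> edges G. src G e = v}. rslope (edge_fun G h e) 0) =
      of_int i * (\<Sum>e\<in>{e \<in> edges G. src G e = v}. rslope (edge_fun G f e) 0) +
      of_int j * (\<Sum>e\<in>{e \<in> edges G. src G e = v}. rslope (edge_fun G g e) 0)"
      unfolding sum_distrib_left sum.distrib[symmetric]
      by (intro sum.cong) (use tropical_curve_edge(3)[OF G] in \<open>auto intro!: rs simp: zero_ereal_def\<close>)
    have 2: "(\<Sum>e\<in>{e \<in> edges G. tgt G e = v \<and> len G e \<noteq> \<infinity>}. lslope (edge_fun G h e) (real_of_ereal (len G e))) =
      of_int i * (\<Sum>e\<in>{e \<in> edges G. tgt G e = v \<and> len G e \<noteq> \<infinity>}. lslope (edge_fun G f e) (real_of_ereal (len G e))) +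
      of_int j * (\<Sum>e\<in>{e \<in> edges G. tgt G e = v \<and> len G e \<noteq> \<infinity>}. lslope (edge_fun G g e) (real_of_ereal (len G e)))"
      unfolding sum_distrib_left sum.distrib[symmetric]
    proof (intro sum.cong refl ls)
      fix ed assume "ed \<in> {e \<in> edges G. tgt G e = v \<and> len G e \<noteq> \<infinity>}"
      then have ed: "ed \<in> edges G" "len G ed \<noteq> \<infinity>" by auto
      show "ed \<in> edges G" "0 < real_of_ereal (len G ed)" "ereal (real_of_ereal (len G ed)) \<le> len G ed"
        using ed tropical_curve_edge(3)[OF G ed(1)] by (cases "len G ed"; simp)+
    qed
    have 3: "(\<Sum>e\<in>{e \<in> edges G. tgt G e = v \<and> len G e = \<infinity>}. end_slope (edge_fun G h e)) =
      of_int i * (\<Sum>e\<in>{e \<in> edges G. tgt G e = v \<and> len G e = \<infinity>}. end_slope (edge_fun G f e)) +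
      of_int j * (\<Sum>e\<in>{e \<in> edges G. tgt G e = v \<and> len G e = \<infinity>}. end_slope (edge_fun G g e))"
      unfolding sum_distrib_left sum.distrib[symmetric]
      by (intro sum.cong refl es) auto
    show ?thesis using Vx by (simp add: ord_def 1 2 3 algebra_simps)
  qed
qed

section \<open>Spread of the maximum 0 at vertices and along edges\<close>

lemma edge_fun_nonpos:
  assumes "tropical_curve G" "\<forall>x\<in>fin_pts G. real_of_ereal (F x) \<le> 0"
    "ed \<in> edges G" "0 \<le> t" "ereal t \<le> len G ed"
  shows "edge_fun G F ed t \<le> 0"
  unfolding edge_fun_def using point_at_fin[OF assms(1,3-5)] assms(2) by blast

text \<open>At a maximum no outgoing slope is positive; for an edge ending at \<open>v\<close> the
  outgoing slope is minus the left slope. As \<open>v\<close> is not at infinity, \<open>ord\<close>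
  has no contribution from end slopes.\<close>

lemma vertex_max_slopes:
  assumes G: "tropical_curve G" and F: "PL_fun G F"
    and le: "\<forall>x\<in>fin_pts G. real_of_ereal (F x) \<le> 0"
    and v: "\<not> inf_end G v" "real_of_ereal (F (Vx v)) = 0"
  shows "f \<in> edges G \<Longrightarrow> src G f = v \<Longrightarrow> rgerm (edge_fun G F f) 0 (rslope (edge_fun G F f) 0)"
    and "f \<in> edges G \<Longrightarrow> src G f = v \<Longrightarrow> rslope (edge_fun G F f) 0 \<le> 0"
    and "f \<in> edges G \<Longrightarrow> tgt G f = v \<Longrightarrow>
      lgerm (edge_fun G F f) (real_of_ereal (len G f)) (lslope (edge_fun G F f) (real_of_ereal (len G f)))"
    and "f \<in> edges G \<Longrightarrow> tgt G f = v \<Longrightarrow> 0 \<le> lslope (edge_fun G F f) (real_of_ereal (len G f))"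
    and "ord G F (Vx v) = (\<Sum>f\<in>{f \<in> edges G. src G f = v}. rslope (edge_fun G F f) 0)
      - (\<Sum>f\<in>{f \<in> edges G. tgt G f = v}. lslope (edge_fun G F f) (real_of_ereal (len G f)))"
proof -
  let ?S = "{e \<in> edges G. src G e = v}" and ?T = "{e \<in> edges G. tgt G e = v}"
  let ?r = "\<lambda>f. rslope (edge_fun G F f) 0" and ?l = "\<lambda>f. lslope (edge_fun G F f) (real_of_ereal (len G f))"
  have fin: "finite ?S" "finite ?T" using G by (auto simp: tropical_curve_def)
  have nonfin: "len G f \<noteq> \<infinity>" if "f \<in> edges G" "tgt G f = v" for f
    using v(1) that by (auto simp: inf_end_def)
  have rg: "rgerm (edge_fun G F f) 0 (?r f)" if "f \<in> edges G" for f
    using tropical_curve_edge(3)[OF G that] by (intro PL_fun_rgerm[OF F that]) (auto simp: zero_ereal_def)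
  have len: "0 < real_of_ereal (len G f)" "ereal (real_of_ereal (len G f)) = len G f"
    if "f \<in> edges G" "len G f \<noteq> \<infinity>" for f
    using tropical_curve_edge(3)[OF G that(1)] that(2) by (cases "len G f"; simp)+
  have lg: "lgerm (edge_fun G F f) (real_of_ereal (len G f)) (?l f)" if "f \<in> edges G" "len G f \<noteq> \<infinity>" for f
    using len[OF that] by (intro PL_fun_lgerm[OF F that(1)]) auto
  have r: "?r f \<le> 0" if "f \<in> ?S" for f
  proof -
    have f: "f \<in> edges G" "src G f = v" using that by auto
    obtain b where b: "0 < b" "ereal b \<le> len G f"
      using tropical_curve_edge(3)[OF G f(1)] by (cases "len G f") (auto intro: that[of 1])
    obtain d where d: "0 < d" "d \<le> b" "\<And>u. 0 \<le> u \<Longrightarrow> u \<le> 0 + d \<Longrightarrow>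
        edge_fun G F f u = edge_fun G F f 0 + ?r f * (u - 0)"
      using rgermE[OF rg[OF f(1)] b(1)] by blast
    have "edge_fun G F f 0 = 0" using v(2) f by (simp add: edge_fun_def point_at_def)
    then have "edge_fun G F f d = ?r f * d" using d(3)[of d] d(1) by simp
    moreover have "ereal d \<le> len G f" using b(2) d(2) by (meson ereal_less_eq(3) order_trans)
    ultimately have "?r f * d \<le> 0" using edge_fun_nonpos[where F = F and t = d, OF G le f(1)] d(1) by simp
    then show ?thesis using d(1) by (simp add: mult_le_0_iff)
  qed
  have l: "0 \<le> ?l f" if "f \<in> ?T" for f
  proof -
    have f: "f \<in> edges G" "tgt G f = v" "len G f \<noteq> \<infinity>" using that nonfin by auto
    let ?L = "real_of_ereal (len G f)"
    have L: "0 < ?L" "ereal ?L = len G f" using len[OF f(1,3)] by auto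
    obtain d where d: "0 < d" "d \<le> ?L" "\<And>u. ?L - d \<le> u \<Longrightarrow> u \<le> ?L \<Longrightarrow>
        edge_fun G F f u = edge_fun G F f ?L + ?l f * (u - ?L)"
      using lgermE[OF lg[OF f(1,3)] L(1)] by blast
    have "edge_fun G F f ?L = 0"
      using v(2) f point_at_simps(2)[OF G f(1) L(2)] by (simp add: edge_fun_def)
    then have "edge_fun G F f (?L - d) = - (?l f * d)" using d(3)[of "?L - d"] d(1) by simp
    moreover have "ereal (?L - d) \<le> ereal ?L" using d(1) by simp
    then have "ereal (?L - d) \<le> len G f" unfolding L(2) .
    ultimately have "- (?l f * d) \<le> 0" using edge_fun_nonpos[where F = F and t = "?L - d", OF G le f(1)] d(2) by simp
    then show ?thesis using d(1) by (simp add: zero_le_mult_iff)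
  qed
  show "rgerm (edge_fun G F f) 0 (?r f)" "?r f \<le> 0" if "f \<in> edges G" "src G f = v"
    using rg r that by auto
  show "lgerm (edge_fun G F f) (real_of_ereal (len G f)) (?l f)" "0 \<le> ?l f" if "f \<in> edges G" "tgt G f = v"
    using lg l nonfin that by auto
  have "{e \<in> edges G. tgt G e = v \<and> len G e \<noteq> \<infinity>} = ?T" "{e \<in> edges G. tgt G e = v \<and> len G e = \<infinity>} = {}"
    using nonfin by auto
  then show "ord G F (Vx v) = (\<Sum>f\<in>?S. ?r f) - (\<Sum>f\<in>?T. ?l f)"
    by (simp only: ord_def point.case sum.empty diff_zero)
qed

text \<open>Nonpositive outgoing slopes with a nonnegative sum all vanish.\<close>

lemma vertex_max_flat:
  assumes G: "tropical_curve G" and F: "PL_fun G F"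
    and le: "\<forall>x\<in>fin_pts G. real_of_ereal (F x) \<le> 0"
    and v: "\<not> inf_end G v" "real_of_ereal (F (Vx v)) = 0" "0 \<le> ord G F (Vx v)"
  shows "f \<in> edges G \<Longrightarrow> src G f = v \<Longrightarrow> rgerm (edge_fun G F f) 0 0"
    and "f \<in> edges G \<Longrightarrow> tgt G f = v \<Longrightarrow> lgerm (edge_fun G F f) (real_of_ereal (len G f)) 0"
proof -
  let ?S = "{e \<in> edges G. src G e = v}" and ?T = "{e \<in> edges G. tgt G e = v}"
  let ?r = "\<lambda>f. rslope (edge_fun G F f) 0" and ?l = "\<lambda>f. lslope (edge_fun G F f) (real_of_ereal (len G f))"
  have fin: "finite ?S" "finite ?T" using G by (auto simp: tropical_curve_def)
  note slopes = vertex_max_slopes[OF G F le v(1,2)]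
  have "(\<Sum>f\<in>?S. ?r f) \<le> 0" "0 \<le> (\<Sum>f\<in>?T. ?l f)"
    using slopes(2,4) by (auto intro!: sum_nonpos sum_nonneg)
  then have "(\<Sum>f\<in>?S. ?r f) = 0" "(\<Sum>f\<in>?T. ?l f) = 0" using v(3) slopes(5) by linarith+
  then have *: "\<forall>f\<in>?S. ?r f = 0" "\<forall>f\<in>?T. ?l f = 0"
    using sum_nonneg_eq_0_iff[OF fin(1), of "\<lambda>f. - ?r f"] sum_nonneg_eq_0_iff[OF fin(2), of ?l] slopes(2,4)
    by (auto simp: sum_negf)
  show "rgerm (edge_fun G F f) 0 0" if "f \<in> edges G" "src G f = v"
    using slopes(1)[OF that] *(1) that by simp
  show "lgerm (edge_fun G F f) (real_of_ereal (len G f)) 0" if "f \<in> edges G" "tgt G f = v"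
    using slopes(3)[OF that] *(2) that by simp
qed

text \<open>At an interior point of an edge, nonnegative \<open>ord\<close> says that the slope does
  not decrease there, which is the convexity required by the two interval lemmas.\<close>

lemma edge_max_spreads:
  assumes G: "tropical_curve G" and F: "PL_fun G F"
    and le: "\<forall>x\<in>fin_pts G. real_of_ereal (F x) \<le> 0"
    and f: "f \<in> edges G" and ab: "0 \<le> a" "a < b" "ereal b \<le> len G f"
    and ord: "\<And>t. a < t \<Longrightarrow> t < b \<Longrightarrow> 0 \<le> ord G F (Ix f t)"
    and t: "a \<le> t" "t \<le> b"
  shows "rgerm (edge_fun G F f) a 0 \<Longrightarrow> edge_fun G F f a = 0 \<Longrightarrow> edge_fun G F f t = 0"
    and "lgerm (edge_fun G F f) b 0 \<Longrightarrow> edge_fun G F f b = 0 \<Longrightarrow> edge_fun G F f t = 0"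
proof -
  let ?g = "edge_fun G F f"
  have le': "ereal u \<le> len G f" if "u \<le> b" for u
    using ab(3) that by (meson ereal_less_eq(3) order_trans)
  have less: "ereal u < len G f" if "u < b" for u
    using ab(3) that by (meson ereal_less(2) less_ereal.simps(1) less_le_trans)
  have rg: "\<exists>s. rgerm ?g u s" if "a \<le> u" "u < b" for u
    using PL_fun_rgerm[OF F f, of u] ab(1) less that by auto
  have lg: "\<exists>s. lgerm ?g u s" if "a < u" "u \<le> b" for u
    using PL_fun_lgerm[OF F f, of u] ab(1) le' that by auto
  have np: "?g u \<le> 0" if "a \<le> u" "u \<le> b" for u
    using edge_fun_nonpos[where F = F and t = u, OF G le f] ab(1) le' that by auto
  have kink: "l \<le> r" if "a < u" "u < b" "rgerm ?g u r" "lgerm ?g u l" for u r l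
    using ord[OF that(1,2)] rslope_eq[OF that(3)] lslope_eq[OF that(4)] by (simp add: ord_def)
  show "?g t = 0" if "rgerm ?g a 0" "?g a = 0"
    by (rule zero_spreads_right[OF ab(2) that]) (use rg lg np kink t in auto)
  show "?g t = 0" if "lgerm ?g b 0" "?g b = 0"
    by (rule zero_spreads_left[OF ab(2) that]) (use rg lg np kink t in auto)
qed

lemma vertex_max_spreads:
  assumes G: "tropical_curve G" and F: "PL_fun G F"
    and le: "\<forall>x\<in>fin_pts G. real_of_ereal (F x) \<le> 0"
    and f: "f \<in> edges G" "len G f \<noteq> \<infinity>"
    and yz: "(src G f = z \<and> tgt G f = y) \<or> (src G f = y \<and> tgt G f = z)"
    and z: "real_of_ereal (F (Vx z)) = 0" "0 \<le> ord G F (Vx z)"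
    and ord: "\<And>t. 0 < t \<Longrightarrow> ereal t < len G f \<Longrightarrow> 0 \<le> ord G F (Ix f t)"
  shows "real_of_ereal (F (Vx y)) = 0"
proof -
  let ?L = "real_of_ereal (len G f)"
  have L: "0 < ?L" "ereal ?L = len G f"
    using tropical_curve_edge(3)[OF G f(1)] f(2) by (cases "len G f"; simp)+
  have zf: "\<not> inf_end G z"
    using yz src_not_inf_end[OF G f(1)] tgt_inf_end_iff[OF G f(1)] f(2) by auto
  have ends: "edge_fun G F f 0 = real_of_ereal (F (Vx (src G f)))"
      "edge_fun G F f ?L = real_of_ereal (F (Vx (tgt G f)))"
    using point_at_simps(1)[OF G f(1)] point_at_simps(2)[OF G f(1) L(2)] by (auto simp: edge_fun_def)
  note flat = vertex_max_flat[OF G F le zf z f(1)]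
  have less: "ereal t < len G f" if "t < ?L" for t
    using that L(2) by (metis less_ereal.simps(1))
  note spread = edge_max_spreads[OF G F le f(1) order_refl L(1)]
  from yz show ?thesis
  proof
    assume *: "src G f = z \<and> tgt G f = y"
    have "edge_fun G F f ?L = 0"
      by (rule spread(1)) (use L ord less flat(1) ends * z(1) in auto)
    then show ?thesis using ends * by simp
  next
    assume *: "src G f = y \<and> tgt G f = z"
    have "edge_fun G F f 0 = 0"
      by (rule spread(2)) (use L ord less flat(2) ends * z(1) in auto)
    then show ?thesis using ends * by simp
  qed
qed

section \<open>Paths in the graph and spread along them\<close>

lemma adjE:
  assumes "(y, z) \<in> adj G E"
  obtains f where "f \<in> E" "(src G f = z \<and> tgt G f = y) \<or> (src G f = y \<and> tgt G f = z)"
  using assms unfolding adj_def by blast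

lemma adjI:
  assumes "f \<in> E" "(src G f = z \<and> tgt G f = y) \<or> (src G f = y \<and> tgt G f = z)"
  shows "(y, z) \<in> adj G E"
  using assms unfolding adj_def by blast

text \<open>An infinite edge is the only edge at its end, so its removal isolates that end.\<close>

lemma non_bridge_finite_length:
  assumes G: "tropical_curve G" and e: "e \<in> edges G" "\<not> is_bridge G e"
  shows "len G e \<noteq> \<infinity>"
proof
  assume inf: "len G e = \<infinity>"
  have "(tgt G e, src G e) \<in> (adj G (edges G - {e}))\<^sup>*"
    using e tropical_curve_edge[OF G e(1)] by (auto simp: is_bridge_def graph_connected_def)
  moreover have "tgt G e \<noteq> src G e" using inf_edge_unique(2)[OF G e(1) inf e(1)] by simp
  ultimately obtain y where "(tgt G e, y) \<in> adj G (edges G - {e})" by (meson converse_rtranclE)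
  then obtain f where "f \<in> edges G - {e}" "src G f = tgt G e \<or> tgt G f = tgt G e"
    by (rule adjE) auto
  then show False using inf_edge_unique(1)[OF G e(1) inf, of f] by auto
qed

text \<open>An infinite end is a dead end: a path that enters it must leave by the same edge, and
  the detour can be deleted.\<close>

lemma finite_length_path:
  assumes G: "tropical_curve G" and E: "E \<subseteq> edges G"
    and uw: "(u, w) \<in> (adj G E)\<^sup>*" "\<not> inf_end G u" "\<not> inf_end G w"
  shows "(u, w) \<in> (adj G {f \<in> E. len G f \<noteq> \<infinity>})\<^sup>*"
proof -
  let ?R = "adj G {f \<in> E. len G f \<noteq> \<infinity>}"
  \<comment> \<open>During a detour into an infinite end, the invariant remembers a finite path to
    the vertex where the detour began.\<close>
  have "if inf_end G w then \<exists>f\<in>edges G. len G f = \<infinity> \<and> tgt G f = w \<and> (u, src G f) \<in> ?R\<^sup>*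
        else (u, w) \<in> ?R\<^sup>*"
    using uw(1)
  proof (induction rule: rtrancl_induct)
    case base
    then show ?case using uw(2) by simp
  next
    case (step y z)
    obtain f where f: "f \<in> E" "(src G f = z \<and> tgt G f = y) \<or> (src G f = y \<and> tgt G f = z)"
      by (rule adjE[OF step(2)])
    have fe: "f \<in> edges G" using f(1) E by blast
    show ?case
    proof (cases "len G f = \<infinity>")
      case True
      from f(2) show ?thesis
      proof
        assume *: "src G f = z \<and> tgt G f = y"
        have "inf_end G y" using tgt_inf_end_iff[OF G fe] True * by auto
        then obtain f' where f': "f' \<in> edges G" "len G f' = \<infinity>" "tgt G f' = y" "(u, src G f') \<in> ?R\<^sup>*"
          using step.IH by auto
        have "f = f'" using inf_edge_unique(1)[OF G f'(1,2) fe] * f'(3) by simp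
        moreover have "\<not> inf_end G z" using src_not_inf_end[OF G fe] * by auto
        ultimately show ?thesis using f'(4) * by auto
      next
        assume *: "src G f = y \<and> tgt G f = z"
        have "\<not> inf_end G y" using src_not_inf_end[OF G fe] * by auto
        then have "(u, src G f) \<in> ?R\<^sup>*" using step.IH * by auto
        moreover have "inf_end G z" using tgt_inf_end_iff[OF G fe] True * by auto
        ultimately show ?thesis using fe True * by auto
      qed
    next
      case False
      then have "\<not> inf_end G y" "\<not> inf_end G z"
        using f(2) src_not_inf_end[OF G fe] tgt_inf_end_iff[OF G fe] by auto
      moreover have "(y, z) \<in> ?R" using f False by (intro adjI) auto
      ultimately show ?thesis using step.IH by (auto intro: rtrancl_into_rtrancl)
    qed
  qed
  then show ?thesis using uw(3) by simp
qed

text \<open>Cutting the path at its first arrival at \<open>q\<close> supplies an edge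
  \<open>h\<close> from \<open>q\<close> to a vertex that is joined to \<open>p\<close> away from
  \<open>q\<close>.\<close>

lemma path_first_visit:
  assumes "(p, q) \<in> (adj G E)\<^sup>*" "p \<noteq> q"
  obtains u h where "(p, u) \<in> (adj G {f \<in> E. src G f \<noteq> q \<and> tgt G f \<noteq> q})\<^sup>*"
    "h \<in> E" "u \<noteq> q" "(src G h = q \<and> tgt G h = u) \<or> (src G h = u \<and> tgt G h = q)"
proof -
  let ?A = "adj G {f \<in> E. src G f \<noteq> q \<and> tgt G f \<noteq> q}"
  let ?P = "\<exists>u h. (p, u) \<in> ?A\<^sup>* \<and> h \<in> E \<and> u \<noteq> q \<and>
     ((src G h = q \<and> tgt G h = u) \<or> (src G h = u \<and> tgt G h = q))"
  have "((p, w) \<in> ?A\<^sup>* \<and> w \<noteq> q) \<or> ?P" if "(p, w) \<in> (adj G E)\<^sup>*" for w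
    using that
  proof (induction rule: rtrancl_induct)
    case base
    then show ?case using assms(2) by simp
  next
    case (step y z)
    show ?case
    proof (cases ?P)
      case False
      then have y: "(p, y) \<in> ?A\<^sup>*" "y \<noteq> q" using step.IH by auto
      obtain f where f: "f \<in> E" "(src G f = z \<and> tgt G f = y) \<or> (src G f = y \<and> tgt G f = z)"
        by (rule adjE[OF step(2)])
      have "z \<noteq> q" using False y f by blast
      moreover have "(y, z) \<in> ?A" using f y(2) \<open>z \<noteq> q\<close> by (intro adjI[of f]) auto
      ultimately show ?thesis using y(1) by (auto intro: rtrancl_into_rtrancl)
    qed blast
  qed
  from this[OF assms(1)] show ?thesis using that by blast
qed

lemma path_max_spreads:
  assumes G: "tropical_curve G" and F: "PL_fun G F"
    and le: "\<forall>x\<in>fin_pts G. real_of_ereal (F x) \<le> 0"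
    and A: "A \<subseteq> {f \<in> edges G. len G f \<noteq> \<infinity>}"
    and ordv: "\<And>f v. f \<in> A \<Longrightarrow> v = src G f \<or> v = tgt G f \<Longrightarrow> 0 \<le> ord G F (Vx v)"
    and orde: "\<And>f t. f \<in> A \<Longrightarrow> 0 < t \<Longrightarrow> ereal t < len G f \<Longrightarrow> 0 \<le> ord G F (Ix f t)"
    and path: "(a, b) \<in> (adj G A)\<^sup>*" and b: "real_of_ereal (F (Vx b)) = 0"
  shows "real_of_ereal (F (Vx a)) = 0"
  using path b
proof (induction rule: rtrancl_induct)
  case (step y z)
  obtain f where f: "f \<in> A" "(src G f = z \<and> tgt G f = y) \<or> (src G f = y \<and> tgt G f = z)"
    by (rule adjE[OF step(2)])
  have fe: "f \<in> edges G" "len G f \<noteq> \<infinity>" using f(1) A by auto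
  have "0 \<le> ord G F (Vx z)" using f by (intro ordv) auto
  then show ?case
    by (intro step.IH vertex_max_spreads[OF G F le fe f(2) step.prems] orde[OF f(1)])
qed

section \<open>Tropical products of generators\<close>

lemma ord_const: "ord G (\<lambda>x. ereal a) x = 0"
proof -
  have [simp]: "edge_fun G (\<lambda>x. ereal a) f = (\<lambda>t. a)" for f by (simp add: edge_fun_def fun_eq_iff)
  have [simp]: "rslope (\<lambda>t. a) t = 0" for t by (intro rslope_eq rgermI[OF zero_less_one]) simp
  have [simp]: "lslope (\<lambda>t. a) t = 0" for t by (intro lslope_eq lgermI[OF zero_less_one]) simp
  have [simp]: "end_slope (\<lambda>t. a) = 0" by (intro end_slope_eq) (simp add: egerm_def)
  show ?thesis by (simp add: ord_def split: point.split)
qed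

text \<open>Degrees and divisors both add under tropical products. The set \<open>U\<close> does not
  grow with the length of the product, since sums of functions linear off \<open>U\<close> are
  linear off \<open>U\<close>; this is how finitely many generators restrict the breakpoints of all
  terms.\<close>

lemma term_section:
  fixes a :: real and gs :: "(nat \<times> (('v, 'e) point \<Rightarrow> ereal)) list"
  defines "T \<equiv> \<lambda>gs x. ereal a + sum_list (map (\<lambda>(k, h). h x) gs)"
  assumes G: "tropical_curve G" and e: "e \<in> edges G"
    and gs: "\<And>k h. (k, h) \<in> set gs \<Longrightarrow> h \<in> RR G (smult_div (int k) D) \<and> PL_off U (edge_fun G h e) (len G e)"
  shows "(\<forall>x\<in>fin_pts G. \<bar>T gs x\<bar> \<noteq> \<infinity>) \<and> PL_fun G (T gs) \<and> PL_off U (edge_fun G (T gs) e) (len G e) \<and>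
    (\<forall>x\<in>pts G. - of_int (int (sum_list (map fst gs)) * D x) \<le> ord G (T gs) x)"
  using gs
proof (induction gs)
  case Nil
  have "edge_fun G (T []) f = (\<lambda>t. a)" for f by (simp add: edge_fun_def T_def fun_eq_iff)
  then show ?case
    using ord_const[of G a] PL_off_const by (auto simp: PL_fun_def T_def)
next
  case (Cons g gs)
  obtain k h where g: "g = (k, h)" by (cases g)
  have h: "h \<in> RR G (smult_div (int k) D)" "PL_off U (edge_fun G h e) (len G e)"
    using Cons.prems[of k h] g by auto
  have prem: "h \<in> RR G (smult_div (int k) D) \<and> PL_off U (edge_fun G h e) (len G e)" if "(k, h) \<in> set gs" for k h
    using Cons.prems[of k h] that by simp
  have IH0: "(\<forall>x\<in>fin_pts G. \<bar>T gs x\<bar> \<noteq> \<infinity>) \<and> PL_fun G (T gs) \<and> PL_off U (edge_fun G (T gs) e) (len G e) \<and>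
    (\<forall>x\<in>pts G. - of_int (int (sum_list (map fst gs)) * D x) \<le> ord G (T gs) x)"
    using prem by (rule Cons.IH)
  have IH: "\<And>x. x \<in> fin_pts G \<Longrightarrow> \<bar>T gs x\<bar> \<noteq> \<infinity>" "PL_fun G (T gs)" "PL_off U (edge_fun G (T gs) e) (len G e)"
    "\<And>x. x \<in> pts G \<Longrightarrow> - of_int (int (sum_list (map fst gs)) * D x) \<le> ord G (T gs) x"
    using IH0 by (elim conjE; simp)+
  have hr: "rational_fun G h" and ho: "\<And>x. x \<in> pts G \<Longrightarrow> - of_int (int k * D x) \<le> ord G h x"
    using h(1) by (force simp: RR_def smult_div_def)+
  have hf: "\<bar>h x\<bar> \<noteq> \<infinity>" if "x \<in> fin_pts G" for x using hr that by (simp add: rational_fun_def)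
  have T: "T (g # gs) x = T gs x + h x" for x by (simp add: T_def g ac_simps)
  have fin: "\<bar>T (g # gs) x\<bar> \<noteq> \<infinity>" if "x \<in> fin_pts G" for x
    unfolding T using IH(1)[OF that] hf[OF that] by (cases "T gs x"; cases "h x") auto
  have eq: "real_of_ereal (T (g # gs) x) = of_int 1 * real_of_ereal (T gs x) + of_int 1 * real_of_ereal (h x)"
    if "x \<in> fin_pts G" for x
    unfolding T using IH(1)[OF that] hf[OF that] by (cases "T gs x"; cases "h x") auto
  note lin = ord_lin[OF G IH(2) rational_fun_PL_fun[OF hr] eq]
  have "PL_off (U \<union> U) (edge_fun G (T (g # gs)) e) (len G e)"
    by (rule PL_off_lin[OF IH(3) h(2)]) (unfold edge_fun_def, rule eq, rule point_at_fin[OF G e])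
  moreover have "- of_int (int (sum_list (map fst (g # gs))) * D x) \<le> ord G (T (g # gs)) x" if "x \<in> pts G" for x
    using lin(2)[OF _ that] IH(4)[OF that] ho[OF that] by (simp add: g algebra_simps)
  ultimately show ?case using fin lin(1) by auto
qed

section \<open>A section with a kink on a non-bridge edge\<close>

lemma PL_off_min_id: "PL_off {k} (\<lambda>t. min t k) L"
  unfolding PL_off_def
proof (intro allI impI)
  fix a b :: real
  assume "0 \<le> a" "a < b" "ereal b \<le> L" "{k} \<inter> {a<..<b} = {}"
  then have "b \<le> k \<or> k \<le> a" by auto
  then show "\<exists>s::int. \<forall>t\<in>{a..b}. min t k = min a k + of_int s * (t - a)"
  proof
    assume "b \<le> k" then show ?thesis using \<open>a < b\<close> by (intro exI[of _ 1]) auto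
  next
    assume "k \<le> a" then show ?thesis by (intro exI[of _ 0]) auto
  qed
qed

lemma PL_off_min_reflect: "PL_off {l - k} (\<lambda>t. min (l - t) k) L"
  unfolding PL_off_def
proof (intro allI impI)
  fix a b :: real
  assume "0 \<le> a" "a < b" "ereal b \<le> L" "{l - k} \<inter> {a<..<b} = {}"
  then have "b \<le> l - k \<or> l - k \<le> a" by auto
  then show "\<exists>s::int. \<forall>t\<in>{a..b}. min (l - t) k = min (l - a) k + of_int s * (t - a)"
  proof
    assume "b \<le> l - k" then show ?thesis using \<open>a < b\<close> by (intro exI[of _ 0]) auto
  next
    assume "l - k \<le> a" then show ?thesis using \<open>a < b\<close> by (intro exI[of _ "-1"]) auto
  qed
qed

text \<open>Midpoint convexity at \<open>t\<close> is easier to check for minima of affine functions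
  than the slopes themselves.\<close>

lemma germ_convex:
  assumes r: "rgerm g t r" and l: "lgerm g t l" and b: "0 < b"
    and conv: "\<And>u. 0 < u \<Longrightarrow> u \<le> b \<Longrightarrow> 2 * g t \<le> g (t + u) + g (t - u)"
  shows "l \<le> r"
proof -
  obtain d where d: "0 < d" "d \<le> b" "\<And>u. t \<le> u \<Longrightarrow> u \<le> t + d \<Longrightarrow> g u = g t + r * (u - t)"
    using rgermE[OF r b] by blast
  obtain d' where d': "0 < d'" "d' \<le> b" "\<And>u. t - d' \<le> u \<Longrightarrow> u \<le> t \<Longrightarrow> g u = g t + l * (u - t)"
    using lgermE[OF l b] by blast
  define m where "m = min d d'"
  have m: "0 < m" "m \<le> d" "m \<le> d'" using d(1) d'(1) by (auto simp: m_def)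
  have "2 * g t \<le> (g t + r * m) + (g t - l * m)"
    using conv[of m] d(2) d(3)[of "t+m"] d'(3)[of "t-m"] m by simp
  then have "l * m \<le> r * m" by simp
  then show ?thesis using m(1) by simp
qed

text \<open>The section constructed here has slope -M on e before its kink and slope M - c after it;
  c is the number of chips left over at q.\<close>

locale kinked_edge =
  fixes G :: "('v, 'e) metric_graph" and e :: 'e and W :: "'v set" and M c :: int
  assumes G: "tropical_curve G"
    and len_ge_1: "\<And>f. f \<in> edges G \<Longrightarrow> 1 \<le> len G f"
    and e: "e \<in> edges G" "len G e \<noteq> \<infinity>"
    and W: "src G e \<notin> W" "tgt G e \<notin> W"
    and W_closed: "\<And>f. f \<in> edges G \<Longrightarrow> f \<noteq> e \<Longrightarrow> src G f \<in> W \<Longrightarrow> tgt G f \<in> insert (tgt G e) W"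
      "\<And>f. f \<in> edges G \<Longrightarrow> f \<noteq> e \<Longrightarrow> tgt G f \<in> W \<Longrightarrow> src G f \<in> insert (tgt G e) W"
    and M: "0 \<le> c" "0 < M" "c < M"
begin

section \<open>The kinked function and its values at the vertices\<close>

definition elen :: "'e \<Rightarrow> real" where "elen f = real_of_ereal (len G f)"

text \<open>The solution of M * kink = (M - c) * (elen e - kink), so that \<open>profile e\<close> is continuous
  and vanishes at both ends of e.\<close>

definition kink :: real where "kink = of_int (M - c) * elen e / of_int (2 * M - c)"

text \<open>Stubs are the half-edges that receive a chip at distance 1/4 from the far end of
  \<open>e\<close>. Edges are oriented arbitrarily, hence two predicates; a loop satisfies both and
  counts as two half-edges.\<close>

definition src_stub :: "'e \<Rightarrow> bool" where
  "src_stub f \<longleftrightarrow> f \<noteq> e \<and> src G f = tgt G e \<and> tgt G f \<in> insert (tgt G e) W"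

definition tgt_stub :: "'e \<Rightarrow> bool" where
  "tgt_stub f \<longleftrightarrow> f \<noteq> e \<and> tgt G f = tgt G e \<and> src G f \<in> insert (tgt G e) W"

definition stub_count :: int where
  "stub_count = int (card {f \<in> edges G. src_stub f} + card {f \<in> edges G. tgt_stub f})"

text \<open>On a loop at the far end of e both half-edges are stubs: near either end one of the two
  subtracted minima is constantly 1/4, which the offset compensates.\<close>

definition offset :: "'e \<Rightarrow> real" where
  "offset f = (if src G f \<in> W \<and> tgt G f \<in> W then - 1/4 else if src_stub f \<and> tgt_stub f then 1/4 else 0)"

text \<open>Outside \<open>e\<close> the function is 0 except beyond the chips on the stubs and on
  \<open>W\<close>, where it is -1/4: along a stub it falls with slope -1 for a quarter unit and is
  then constant. The bend is the chip.\<close>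

definition profile :: "'e \<Rightarrow> real \<Rightarrow> real" where
  "profile f t =
     (if f = e then if t \<le> kink then - of_int M * t else - of_int (M - c) * (elen e - t)
      else offset f - (if src_stub f then min t (1/4) else 0)
                    - (if tgt_stub f then min (elen f - t) (1/4) else 0))"

definition bump :: "('v, 'e) point \<Rightarrow> ereal" where
  "bump x = ereal (case x of Ix f t \<Rightarrow> profile f t | Vx v \<Rightarrow> if v \<in> W then - 1/4 else 0)"

lemma elen: "f \<in> edges G \<Longrightarrow> len G f \<noteq> \<infinity> \<Longrightarrow> ereal (elen f) = len G f \<and> 1 \<le> elen f"
  using len_ge_1[of f] by (cases "len G f") (auto simp: elen_def one_ereal_def)

lemma not_inf_end: "\<not> inf_end G (src G e)" "\<not> inf_end G (tgt G e)"
  using src_not_inf_end[OF G e(1)] tgt_inf_end_iff[OF G e(1)] e(2) by auto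

lemma inf_not_tgt_stub: "f \<in> edges G \<Longrightarrow> len G f = \<infinity> \<Longrightarrow> \<not> tgt_stub f"
  using not_inf_end(2) by (auto simp: inf_end_def tgt_stub_def)

lemma kink: "0 < kink" "kink < elen e" "of_int M * kink = of_int (M - c) * (elen e - kink)"
proof -
  have l: "1 \<le> elen e" using elen[OF e] by simp
  have "0 < 2 * M - c" using M by linarith
  then have pos: "(0::real) < of_int (2 * M - c)" by (simp only: of_int_0_less_iff)
  have "0 < M - c" using M by linarith
  then have Mc: "(0::real) < of_int (M - c)" by (simp only: of_int_0_less_iff)
  show "0 < kink" unfolding kink_def using l pos Mc by (intro divide_pos_pos mult_pos_pos) auto
  have eq: "of_int (2 * M - c) * kink = of_int (M - c) * elen e" using pos by (simp add: kink_def)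
  then show "of_int M * kink = of_int (M - c) * (elen e - kink)" by (simp add: algebra_simps)
  have "(of_int (M - c) :: real) < of_int (2 * M - c)" using M(2) by (simp only: of_int_less_iff)
  then have "of_int (M - c) * elen e < of_int (2 * M - c) * elen e"
    using l by (intro mult_strict_right_mono) auto
  then show "kink < elen e" unfolding kink_def using pos by (simp only: pos_divide_less_eq mult.commute)
qed

text \<open>Together with \<open>profile_tgt\<close> this shows that the formulas on different edges
  agree at common vertices. By \<open>W_closed\<close>, an edge leaving \<open>W\<close> can only
  lead to the far end of \<open>e\<close> and is then a stub.\<close>

lemma profile_src: "f \<in> edges G \<Longrightarrow> profile f 0 = (if src G f \<in> W then - 1/4 else 0)"
proof (cases "f = e")
  case True
  then show ?thesis using kink(1) W by (simp add: profile_def)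
next
  case False
  assume f: "f \<in> edges G"
  have "1/4 \<le> elen f" if "tgt_stub f"
    using elen[OF f] inf_not_tgt_stub[OF f] that by force
  then show ?thesis using False W W_closed[OF f False]
    by (auto simp: profile_def offset_def src_stub_def tgt_stub_def)
qed

lemma profile_tgt:
  assumes f: "f \<in> edges G" and fin: "len G f \<noteq> \<infinity>"
  shows "profile f (elen f) = (if tgt G f \<in> W then - 1/4 else 0)"
proof (cases "f = e")
  case True
  then show ?thesis using kink(2) W by (simp add: profile_def)
next
  case False
  then show ?thesis using W W_closed[OF f False] elen[OF f fin]
    by (auto simp: profile_def offset_def src_stub_def tgt_stub_def)
qed

lemma edge_bump:
  assumes f: "f \<in> edges G" and t: "0 \<le> t" "ereal t \<le> len G f"
  shows "edge_fun G bump f t = profile f t"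
proof -
  consider "t = 0" | "ereal t = len G f" "t \<noteq> 0" | "0 < t" "ereal t < len G f"
    using t by fastforce
  then show ?thesis
  proof cases
    case 1
    then show ?thesis using profile_src[OF f] point_at_simps(1)[OF G f]
      by (simp add: edge_fun_def bump_def)
  next
    case 2
    then have "len G f \<noteq> \<infinity>" by (metis PInfty_neq_ereal(1))
    moreover from this have "t = elen f" using elen[OF f] 2 by (metis ereal.inject)
    ultimately show ?thesis using profile_tgt[OF f] point_at_simps(2)[OF G f 2(1)]
      by (simp add: edge_fun_def bump_def)
  next
    case 3
    then show ?thesis using point_at_simps(3)[OF G f] by (simp add: edge_fun_def bump_def)
  qed
qed

text \<open>The definition uses the left branch at \<open>kink\<close>; by the choice of
  \<open>kink\<close> the right branch has the same value there.\<close>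

lemma profile_right: "kink \<le> t \<Longrightarrow> profile e t = - of_int (M - c) * (elen e - t)"
  using kink(3) by (cases "t = kink") (auto simp: profile_def algebra_simps)

lemma PL_off_profile: "\<exists>B. finite B \<and> PL_off B (profile f) L"
proof (cases "f = e")
  case True
  have "PL_off {kink} (profile e) L"
    unfolding PL_off_def
  proof (intro allI impI)
    fix a b :: real
    assume "0 \<le> a" "a < b" "ereal b \<le> L" "{kink} \<inter> {a<..<b} = {}"
    then have "b \<le> kink \<or> kink \<le> a" by auto
    then show "\<exists>s::int. \<forall>t\<in>{a..b}. profile e t = profile e a + of_int s * (t - a)"
    proof
      assume "b \<le> kink"
      then show ?thesis using \<open>a < b\<close>
        by (intro exI[of _ "-M"]) (auto simp: profile_def algebra_simps)
    next
      assume *: "kink \<le> a"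
      have "profile e t = profile e a + of_int (M - c) * (t - a)" if "t \<in> {a..b}" for t
        using profile_right[of t] profile_right[of a] * that by (simp add: algebra_simps)
      then show ?thesis by blast
    qed
  qed
  then show ?thesis using True by blast
next
  case False
  let ?i = "if src_stub f then -1 else 0 :: int" and ?j = "if tgt_stub f then -1 else 0 :: int"
  have "PL_off ({1/4} \<union> {elen f - 1/4}) (\<lambda>t. of_int ?i * min t (1/4) + of_int ?j * min (elen f - t) (1/4)) L"
    by (rule PL_off_lin[OF PL_off_min_id PL_off_min_reflect refl])
  then have "PL_off ({1/4} \<union> {elen f - 1/4} \<union> {}) (profile f) L"
    by (rule PL_off_lin[OF _ PL_off_const[of _ "offset f"], where i = 1 and j = 1])
      (use False in \<open>simp add: profile_def\<close>)
  then show ?thesis by (intro exI[of _ "{1/4} \<union> {elen f - 1/4} \<union> {}"]) simp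
qed

lemma PL_fun_bump: "PL_fun G bump"
  unfolding PL_fun_def using PL_off_profile PL_off_cong edge_bump by metis

section \<open>The divisor of \<open>bump\<close>\<close>

lemma rgerm_edge_bump:
  assumes "f \<in> edges G" "0 \<le> t" "0 < d" "ereal (t + d) \<le> len G f"
    "\<And>u. t \<le> u \<Longrightarrow> u \<le> t + d \<Longrightarrow> profile f u = profile f t + s * (u - t)"
  shows "rgerm (edge_fun G bump f) t s"
proof (rule rgermI[OF assms(3)])
  fix u assume u: "t \<le> u" "u \<le> t + d"
  have "ereal u \<le> len G f" "ereal t \<le> len G f"
    using assms(3,4) u by (meson ereal_less_eq(3) order_trans)+
  then show "edge_fun G bump f u = edge_fun G bump f t + s * (u - t)"
    using edge_bump[OF assms(1), of u] edge_bump[OF assms(1), of t] assms(5)[OF u] u assms(2) by simp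
qed

lemma lgerm_edge_bump:
  assumes "f \<in> edges G" "0 < d" "d \<le> t" "ereal t \<le> len G f"
    "\<And>u. t - d \<le> u \<Longrightarrow> u \<le> t \<Longrightarrow> profile f u = profile f t + s * (u - t)"
  shows "lgerm (edge_fun G bump f) t s"
proof (rule lgermI[OF assms(2)])
  fix u assume u: "t - d \<le> u" "u \<le> t"
  have "ereal u \<le> len G f"
    using assms(4) u by (meson ereal_less_eq(3) order_trans)
  then show "edge_fun G bump f u = edge_fun G bump f t + s * (u - t)"
    using edge_bump[OF assms(1), of u] edge_bump[OF assms(1), of t] assms(2-4) assms(5)[OF u] u by simp
qed

lemma rslope_bump:
  assumes f: "f \<in> edges G"
  shows "rslope (edge_fun G bump f) 0 = (if f = e then - of_int M else if src_stub f then -1 else 0)"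
proof (cases "f = e")
  case True
  have "ereal (0 + kink) \<le> ereal (elen e)" using kink(2) by simp
  then have "ereal (0 + kink) \<le> len G e" using elen[OF e] by simp
  then show ?thesis
    using True e kink(1) by (intro rslope_eq rgerm_edge_bump[where d = kink]) (auto simp: profile_def)
next
  case False
  \<comment> \<open>As all lengths are at least 1, a possible stub at the other end of
    \<open>f\<close> contributes a constant on the first quarter.\<close>
  have "ereal (0 + 1/4) \<le> 1" by (simp add: one_ereal_def)
  then have "ereal (0 + 1/4) \<le> len G f" using len_ge_1[OF f] order_trans by blast
  moreover have "1 \<le> elen f" if "tgt_stub f"
    using elen[OF f] inf_not_tgt_stub[OF f] that by blast
  ultimately show ?thesis
    using False f by (intro rslope_eq rgerm_edge_bump[where d = "1/4"]) (auto simp: profile_def)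
qed

lemma lslope_bump:
  assumes f: "f \<in> edges G" "len G f \<noteq> \<infinity>"
  shows "lslope (edge_fun G bump f) (elen f) = (if f = e then of_int (M - c) else if tgt_stub f then 1 else 0)"
proof (cases "f = e")
  case True
  have "lgerm (edge_fun G bump e) (elen e) (of_int (M - c))"
  proof (rule lgerm_edge_bump[OF e(1)])
    show "profile e u = profile e (elen e) + of_int (M - c) * (u - elen e)"
      if "elen e - (elen e - kink) \<le> u" "u \<le> elen e" for u
      using profile_right[of u] profile_right[of "elen e"] that kink(2) by (simp add: algebra_simps)
  qed (use kink(1,2) elen[OF e] in auto)
  then show ?thesis using True by (simp add: lslope_eq)
next
  case False
  have l: "1 \<le> elen f" "ereal (elen f) \<le> len G f" using elen[OF f] by auto
  have lin: "profile f u = profile f (elen f) + (if tgt_stub f then 1 else 0) * (u - elen f)"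
    if "elen f - 1/4 \<le> u" "u \<le> elen f" for u
    using that False l by (simp add: profile_def)
  have "lgerm (edge_fun G bump f) (elen f) (if tgt_stub f then 1 else 0)"
    by (rule lgerm_edge_bump[OF f(1) _ _ l(2) lin]) (use l(1) in auto)
  then show ?thesis using False by (simp add: lslope_eq)
qed

lemma profile_inf:
  assumes "f \<in> edges G" "len G f = \<infinity>" "1/4 \<le> t"
  shows "profile f t = (if tgt G f \<in> W then - 1/4 else 0)"
proof -
  have "f \<noteq> e" using assms(2) e(2) by blast
  then show ?thesis
    using W W_closed[OF assms(1)] inf_not_tgt_stub[OF assms(1,2)] assms(3)
    by (auto simp: profile_def offset_def src_stub_def tgt_stub_def)
qed

lemma end_slope_bump:
  assumes "f \<in> edges G" "len G f = \<infinity>"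
  shows "end_slope (edge_fun G bump f) = 0"
proof (rule end_slope_eq)
  show "egerm (edge_fun G bump f) 0"
    unfolding egerm_def using assms
    by (intro exI[of _ "1/4"]) (simp add: edge_bump profile_inf)
qed

lemma bump_near_infinity:
  assumes f: "f \<in> edges G" "len G f = \<infinity>"
  shows "\<forall>\<^sub>F t in at_top. bump (point_at G f t) = bump (Vx (tgt G f))"
proof (rule eventually_at_top_linorderI)
  show "bump (point_at G f t) = bump (Vx (tgt G f))" if "1/4 \<le> t" for t
    using that point_at_simps(3)[OF G f(1), of t] profile_inf[OF f that] by (simp add: bump_def f(2))
qed

text \<open>The two conditions are added rather than nested because \<open>e\<close> may be a loop.
  After adding \<open>M\<close> chips at each end of \<open>e\<close>, exactly
  \<open>c - stub_count\<close> chips remain at the far end and none at any other vertex.\<close>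

lemma ord_bump_vertex:
  "ord G bump (Vx v) = - (if v = src G e then of_int M else 0)
     - (if v = tgt G e then of_int (M - c + stub_count) else 0)"
proof -
  have fin: "finite (edges G)" using G by (simp add: tropical_curve_def)
  have nt: "{f \<in> edges G. tgt G f = v \<and> len G f \<noteq> \<infinity> \<and> tgt_stub f} = (if v = tgt G e then {f \<in> edges G. tgt_stub f} else {})"
    using inf_not_tgt_stub by (auto simp: tgt_stub_def)
  have ns: "{f \<in> edges G. src G f = v \<and> src_stub f} = (if v = tgt G e then {f \<in> edges G. src_stub f} else {})"
    by (auto simp: src_stub_def)
  \<comment> \<open>Since \<open>e\<close> is never a stub, the slope splits into two independent
    summands, one for \<open>e\<close> and one counting stubs.\<close>
  have "(\<Sum>f\<in>{f \<in> edges G. src G f = v}. rslope (edge_fun G bump f) 0) =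
    (\<Sum>f\<in>{f \<in> edges G. src G f = v}. (if f = e then - of_int M else 0) + (if src_stub f then -1 else 0))"
    by (intro sum.cong) (auto simp: rslope_bump src_stub_def)
  also have "\<dots> = - (if v = src G e then of_int M else 0)
      - (if v = tgt G e then of_nat (card {f \<in> edges G. src_stub f}) else 0)"
    using fin e(1) ns by (simp add: sum.distrib sum.If_cases sum.delta Int_def conj_assoc)
  finally have 1: "(\<Sum>f\<in>{f \<in> edges G. src G f = v}. rslope (edge_fun G bump f) 0) = \<dots>" .
  have "(\<Sum>f\<in>{f \<in> edges G. tgt G f = v \<and> len G f \<noteq> \<infinity>}. lslope (edge_fun G bump f) (real_of_ereal (len G f))) =
    (\<Sum>f\<in>{f \<in> edges G. tgt G f = v \<and> len G f \<noteq> \<infinity>}. (if f = e then of_int (M - c) else 0) + (if tgt_stub f then 1 else 0))"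
    by (intro sum.cong) (auto simp: lslope_bump tgt_stub_def elen_def[symmetric])
  also have "\<dots> = (if v = tgt G e then of_int (M - c) else 0)
      + (if v = tgt G e then of_nat (card {f \<in> edges G. tgt_stub f}) else 0)"
    using fin e nt by (simp add: sum.distrib sum.If_cases sum.delta Int_def conj_assoc)
  finally have 2: "(\<Sum>f\<in>{f \<in> edges G. tgt G f = v \<and> len G f \<noteq> \<infinity>}. lslope (edge_fun G bump f) (real_of_ereal (len G f))) = \<dots>" .
  have 3: "(\<Sum>f\<in>{f \<in> edges G. tgt G f = v \<and> len G f = \<infinity>}. end_slope (edge_fun G bump f)) = 0"
    by (intro sum.neutral) (auto simp: end_slope_bump)
  show ?thesis by (simp add: ord_def 1 2 3 stub_count_def)
qed

lemma ord_bump_linear: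
  assumes f: "f \<in> edges G" and t: "0 < t" "ereal t < len G f" and d: "0 < d"
    and lin: "\<And>u. 0 \<le> u \<Longrightarrow> ereal u \<le> len G f \<Longrightarrow> \<bar>u - t\<bar> \<le> d \<Longrightarrow> profile f u = profile f t + s * (u - t)"
  shows "ord G bump (Ix f t) = 0"
proof -
  obtain b where b: "t < b" "ereal b \<le> len G f"
    using t(2) by (cases "len G f") (auto intro: that[of "t+1"])
  have le: "ereal u \<le> len G f" if "u \<le> b" for u
    using b(2) that by (meson ereal_less_eq(3) order_trans)
  have "rslope (edge_fun G bump f) t = s"
    using t d b le by (intro rslope_eq rgerm_edge_bump[OF f, where d = "min d (b - t)"] lin) auto
  moreover have "lslope (edge_fun G bump f) t = s"
    using t d b le by (intro lslope_eq lgerm_edge_bump[OF f, where d = "min d t"] lin) auto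
  ultimately show ?thesis by (simp add: ord_def)
qed

lemma ord_bump_e:
  assumes t: "0 < t" "ereal t < len G e" "t \<noteq> kink"
  shows "ord G bump (Ix e t) = 0"
proof (cases "t < kink")
  case True
  then show ?thesis
    by (intro ord_bump_linear[OF e(1) t(1,2), of "kink - t" "- of_int M"]) (auto simp: profile_def algebra_simps)
next
  case False
  \<comment> \<open>Half the distance keeps the neighbourhood strictly to the right of
    \<open>kink\<close>, inside the second branch of \<open>profile\<close>.\<close>
  then show ?thesis using t(3)
    by (intro ord_bump_linear[OF e(1) t(1,2), of "(t - kink)/2" "of_int (M - c)"])
      (auto simp: profile_def algebra_simps abs_le_iff field_simps)
qed

lemma ord_bump_no_stub:
  assumes "f \<in> edges G" "0 < t" "ereal t < len G f" "f \<noteq> e" "\<not> src_stub f" "\<not> tgt_stub f"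
  shows "ord G bump (Ix f t) = 0"
proof (rule ord_bump_linear[OF assms(1-3) zero_less_one])
  show "profile f u = profile f t + 0 * (u - t)" for u
    using assms(4-6) by (simp add: profile_def)
qed

text \<open>Outside \<open>e\<close> the profile is a constant minus minima of affine functions,
  hence convex. On \<open>e\<close> the slope jumps upwards at the kink.\<close>

lemma ord_bump_edge_nonneg:
  assumes f: "f \<in> edges G" and t: "0 < t" "ereal t < len G f"
  shows "0 \<le> ord G bump (Ix f t)"
proof -
  obtain b where b: "t < b" "ereal b \<le> len G f"
    using t(2) by (cases "len G f") (auto intro: that[of "t+1"])
  have le: "ereal u \<le> len G f" if "u \<le> b" for u
    using b(2) that by (meson ereal_less_eq(3) order_trans)
  define d where "d = min t (b - t)"
  have d: "0 < d" "d \<le> t" "t + d \<le> b" using t(1) b(1) by (auto simp: d_def)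
  have efun: "edge_fun G bump f u = profile f u" if "0 \<le> u" "u \<le> b" for u
    using edge_bump[OF f that(1) le[OF that(2)]] .
  show ?thesis
  proof (cases "f = e \<and> t \<noteq> kink")
    case True
    then show ?thesis using ord_bump_e t by auto
  next
    case False
    have "2 * profile f t \<le> profile f (t + u) + profile f (t - u)" if u: "0 < u" "u \<le> d" for u
    proof (cases "f = e")
      case True
      then have "t = kink" using False by simp
      \<comment> \<open>The slope jumps by \<open>2 * M - c\<close> at the kink, so the convexity
        inequality holds with this excess times \<open>u\<close>.\<close>
      have "(of_int c :: real) \<le> of_int (2 * M)" using M by (subst of_int_le_iff) linarith
      then have le: "0 \<le> u * of_int (2 * M) - u * of_int c"
        using u(1) by (simp add: mult_left_mono)
      have "- of_int (M - c) * (elen e - (kink + u)) + - of_int M * (kink - u) =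
        2 * (- of_int M * kink) + (u * of_int (2 * M) - u * of_int c)"
        using kink(3) by (simp add: algebra_simps)
      moreover have "profile f t = - of_int M * kink" "profile f (t - u) = - of_int M * (kink - u)"
        "profile f (t + u) = - of_int (M - c) * (elen e - (kink + u))"
        using True \<open>t = kink\<close> u by (auto simp: profile_def)
      ultimately show ?thesis using le by linarith
    next
      case False
      have "min (t + u) (1/4) + min (t - u) (1/4) \<le> 2 * min t (1/4)"
        "min (elen f - (t + u)) (1/4) + min (elen f - (t - u)) (1/4) \<le> 2 * min (elen f - t) (1/4)"
        by (auto simp: min_def)
      then show ?thesis using False by (simp add: profile_def)
    qed
    note conv = this
    have "lslope (edge_fun G bump f) t \<le> rslope (edge_fun G bump f) t"
    proof (rule germ_convex[OF PL_fun_rgerm[OF PL_fun_bump f less_imp_le[OF t(1)] t(2)]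
          PL_fun_lgerm[OF PL_fun_bump f t(1) less_imp_le[OF t(2)]] d(1)])
      fix u assume u: "0 < u" "u \<le> d"
      have "0 \<le> t" "t \<le> b" "0 \<le> t + u" "t + u \<le> b" "0 \<le> t - u" "t - u \<le> b"
        using t(1) d u by linarith+
      then show "2 * edge_fun G bump f t \<le> edge_fun G bump f (t + u) + edge_fun G bump f (t - u)"
        using conv[OF u] efun[of t] efun[of "t + u"] efun[of "t - u"] by simp
    qed
    then show ?thesis by (simp add: ord_def)
  qed
qed

section \<open>The way of the maximum around a cycle through \<open>e\<close>\<close>

text \<open>\<open>F\<close> will be a term minus the section. By \<open>cs\<close>, the bound for
  \<open>ord\<close> at \<open>q\<close> is 0 if there are stubs and -1 otherwise. Inside stubs no
  bound is given, so the route from \<open>q\<close> to \<open>p\<close> has to avoid them.\<close>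

lemma max_spreads_around:
  defines "q \<equiv> tgt G e" and "p \<equiv> src G e"
  assumes F: "PL_fun G F"
    and le: "\<forall>x\<in>fin_pts G. real_of_ereal (F x) \<le> 0"
    and ordv: "\<And>v. v \<in> verts G \<Longrightarrow> (if v = q then of_int (stub_count - c) else 0) \<le> ord G F (Vx v)"
    and orde: "\<And>f t. f \<in> edges G \<Longrightarrow> 0 < t \<Longrightarrow> ereal t < len G f \<Longrightarrow>
      (if f = e then t \<noteq> kink else \<not> src_stub f \<and> \<not> tgt_stub f) \<Longrightarrow> 0 \<le> ord G F (Ix f t)"
    and start: "rgerm (edge_fun G F e) kink 0" "edge_fun G F e kink = 0"
    and Wdef: "W = {w \<in> verts G. w \<noteq> q \<and> (p, w) \<notin> (adj G {f \<in> edges G - {e}. src G f \<noteq> q \<and> tgt G f \<noteq> q})\<^sup>*}"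
    and path: "(p, q) \<in> (adj G (edges G - {e}))\<^sup>*"
    and cs: "c = (if stub_count = 0 then 1 else stub_count)"
    and val: "valence G q \<noteq> 2"
    and t: "0 \<le> t" "t \<le> kink"
  shows "edge_fun G F e t = 0"
proof -
  let ?A = "{f \<in> edges G - {e}. src G f \<noteq> q \<and> tgt G f \<noteq> q}"
  let ?S = "{f \<in> edges G. src G f = q}" and ?T = "{f \<in> edges G. tgt G f = q}"
  have fin: "finite (edges G)" using G by (simp add: tropical_curve_def)
  have pq: "\<not> inf_end G p" "\<not> inf_end G q" "p \<in> verts G" "q \<in> verts G"
    using not_inf_end tropical_curve_edge[OF G e(1)] by (auto simp: p_def q_def)
  have le_e: "ereal (elen e) = len G e" "real_of_ereal (len G e) = elen e"
    using elen[OF e] by (auto simp: elen_def)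
  have less_e: "ereal u < len G e" if "u < elen e" for u
    using that le_e(1) by (metis less_ereal.simps(1))
  have stub_fin: "finite {f \<in> edges G. src_stub f}" "finite {f \<in> edges G. tgt_stub f}" using fin by auto
  have "edge_fun G F e (elen e) = 0"
    by (rule edge_max_spreads(1)[OF G F le e(1) less_imp_le[OF kink(1)] kink(2)])
      (use kink orde[OF e(1)] less_e le_e start in auto)
  then have Fq: "real_of_ereal (F (Vx q)) = 0"
    using point_at_simps(2)[OF G e(1) le_e(1)] by (simp add: edge_fun_def q_def)
  \<comment> \<open>Without stubs, every half-edge at \<open>q\<close> that does not belong to
    \<open>e\<close> leads to a vertex joined to \<open>p\<close> away from
    \<open>q\<close>.\<close>
  have no_stub: "src G f \<notin> insert q W \<and> tgt G f = q \<or> src G f = q \<and> tgt G f \<notin> insert q W"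
    if "stub_count = 0" "f \<in> edges G" "f \<noteq> e" "src G f = q \<or> tgt G f = q" for f
  proof -
    have "{f \<in> edges G. src_stub f} = {}" "{f \<in> edges G. tgt_stub f} = {}"
      using that(1) stub_fin unfolding stub_count_def by (simp_all only: of_nat_eq_0_iff add_eq_0_iff_both_eq_0 card_0_eq zero_le)
    then have "\<not> src_stub f" "\<not> tgt_stub f" using that(2) by blast+
    then show ?thesis using that(3,4) by (auto simp: src_stub_def tgt_stub_def q_def)
  qed
  have Fp: "real_of_ereal (F (Vx p)) = 0 \<and> 0 \<le> ord G F (Vx p)"
  proof (cases "p = q")
    case True
    \<comment> \<open>For a loop \<open>e\<close> the maximum is at \<open>p\<close> already, and a
      chip at \<open>q\<close> must be excluded. Without stubs all other vertices would lie in
      \<open>W\<close>, so \<open>e\<close> would be the only edge at \<open>q\<close>, which would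
      have valence 2.\<close>
    have "stub_count \<noteq> 0"
    proof
      assume 0: "stub_count = 0"
      have "(p, w) \<notin> (adj G ?A)\<^sup>*" if "w \<noteq> q" for w
      proof
        assume "(p, w) \<in> (adj G ?A)\<^sup>*"
        then show False
        proof (cases rule: converse_rtranclE)
          case base
          then show False using that True by simp
        next
          case (step y)
          from step(1) show False by (rule adjE) (use True in auto)
        qed
      qed
      then have "v \<in> W" if "v \<in> verts G" "v \<noteq> q" for v
        using that Wdef by auto
      then have "f = e" if "f \<in> edges G" "src G f = q \<or> tgt G f = q" for f
        using no_stub[OF 0 that(1)] that tropical_curve_edge[OF G that(1)] by blast
      then have "?S = {e}" "?T = {e}" using e(1) True by (auto simp: p_def q_def)
      then show False using val by (simp add: valence_def)
    qed
    then show ?thesis using Fq ordv[OF pq(4)] cs True by simp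
  next
    case False
    obtain u0 h where h: "(p, u0) \<in> (adj G ?A)\<^sup>*" "h \<in> edges G - {e}" "u0 \<noteq> q"
        "(src G h = q \<and> tgt G h = u0) \<or> (src G h = u0 \<and> tgt G h = q)"
      by (rule path_first_visit[OF path False])
    note slopes = vertex_max_slopes[OF G F le pq(2) Fq]
    let ?r = "\<lambda>f. rslope (edge_fun G F f) 0" and ?l = "\<lambda>f. lslope (edge_fun G F f) (real_of_ereal (len G f))"
    \<comment> \<open>The exit from \<open>q\<close>: a flat half-edge outside \<open>e\<close> that
      leads towards \<open>p\<close>.\<close>
    have "\<exists>f u. f \<in> edges G - {e} \<and> u \<notin> insert q W \<and>
      (src G f = q \<and> tgt G f = u \<and> ?r f = 0 \<or> src G f = u \<and> tgt G f = q \<and> ?l f = 0)"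
    proof (cases "stub_count = 0")
      case True
      show ?thesis
      proof (rule ccontr)
        assume none: "\<not> ?thesis"
        \<comment> \<open>By integrality, a nonzero outgoing slope at the maximum is at most
          -1.\<close>
        have r: "?r f \<le> -1" if "f \<in> ?S" for f
        proof -
          have f: "f \<in> edges G" "src G f = q" "f \<noteq> e" using that False by (auto simp: p_def)
          then have "?r f \<noteq> 0" using none no_stub[OF True f(1,3)] by auto
          moreover have "?r f \<in> \<int>" using tropical_curve_edge(3)[OF G f(1)]
            by (intro PL_fun_integer_slope(1)[OF F f(1)]) (auto simp: zero_ereal_def)
          ultimately show ?thesis using slopes(2)[OF f(1,2)] by (auto elim!: Ints_cases)
        qed
        have l: "(if f = e then 0 else 1) \<le> ?l f" if "f \<in> ?T" for f
        proof (cases "f = e")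
          case True
          then show ?thesis using slopes(4) e(1) that by auto
        next
          case f_e: False
          have f: "f \<in> edges G" "tgt G f = q" using that by auto
          then have "?l f \<noteq> 0" using none no_stub[OF True f(1) f_e] f_e by auto
          moreover have "len G f \<noteq> \<infinity>" using pq(2) f by (auto simp: inf_end_def)
          then have "?l f \<in> \<int>" using elen[OF f(1)]
            by (intro PL_fun_integer_slope(2)[OF F f(1)]) (auto simp flip: elen_def)
          ultimately show ?thesis using slopes(4)[OF f] f_e by (auto elim!: Ints_cases)
        qed
        have eT: "e \<in> ?T" using e(1) by (simp add: q_def)
        have "(\<Sum>f\<in>?S. ?r f) \<le> (\<Sum>f\<in>?S. -1)" by (intro sum_mono r)
        moreover have "(\<Sum>f\<in>?T. if f = e then 0 else 1) \<le> (\<Sum>f\<in>?T. ?l f)" by (intro sum_mono l)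
        moreover have "(\<Sum>f\<in>?T. if f = e then 0 else (1::real)) = of_nat (card (?T - {e}))"
          using fin eT by (simp add: sum.If_cases Int_def Diff_eq)
        \<comment> \<open>This bound allows at most one steep half-edge besides that of
          \<open>e\<close>. As the valence is not 2, there would be none at all, contradicting the
          existence of \<open>h\<close>.\<close>
        moreover have "-1 \<le> ord G F (Vx q)" using ordv[OF pq(4)] cs True by simp
        ultimately have "real (card ?S) + real (card (?T - {e})) \<le> 1" using slopes(5) by simp
        moreover have "card ?T = Suc (card (?T - {e}))" using fin eT by (intro card.remove) auto
        ultimately have "card ?S + card ?T \<le> 2" by linarith
        then have "card ?S + card (?T - {e}) = 0"
          using val \<open>card ?T = Suc (card (?T - {e}))\<close> by (simp add: valence_def)
        then have "?S = {}" "?T - {e} = {}" using fin by auto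
        then show False using h(2,4) by blast
      qed
    next
      case False
      \<comment> \<open>With stubs the chips at \<open>q\<close> are used up, so every slope at
        \<open>q\<close> vanishes and \<open>h\<close> itself is an exit.\<close>
      then have o: "0 \<le> ord G F (Vx q)" using ordv[OF pq(4)] cs by simp
      have "u0 \<notin> W" using h(1) Wdef by auto
      moreover have "?r h = 0" if "src G h = q"
        using vertex_max_flat(1)[OF G F le pq(2) Fq o _ that] h(2) by (auto intro: rslope_eq)
      moreover have "?l h = 0" if "tgt G h = q"
        using vertex_max_flat(2)[OF G F le pq(2) Fq o _ that] h(2) by (auto intro: lslope_eq)
      ultimately show ?thesis using h(2-4) by blast
    qed
    then obtain f u where f: "f \<in> edges G" "f \<noteq> e" and u: "u \<noteq> q" "u \<notin> W"
      and fu: "src G f = q \<and> tgt G f = u \<and> ?r f = 0 \<or> src G f = u \<and> tgt G f = q \<and> ?l f = 0"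
      by blast
    have pu: "(p, u) \<in> (adj G ?A)\<^sup>*"
      using fu tropical_curve_edge[OF G f(1)] u Wdef by auto
    \<comment> \<open>At an infinite end \<open>f\<close> would be the only edge, but the path from
      \<open>p\<close> arrives at \<open>u\<close> by an edge that does not touch
      \<open>q\<close>.\<close>
    have u_fin: "\<not> inf_end G u"
    proof
      assume "inf_end G u"
      then obtain e0 where e0: "e0 \<in> edges G" "len G e0 = \<infinity>" "tgt G e0 = u" by (auto simp: inf_end_def)
      have "f = e0" using inf_edge_unique(1)[OF G e0(1,2) f(1)] fu e0(3) by auto
      have "p \<noteq> u" using \<open>inf_end G u\<close> pq(1) by auto
      with pu obtain y where "(y, u) \<in> adj G ?A" by (cases rule: rtranclE) auto
      then obtain f' where f': "f' \<in> ?A" "src G f' = u \<or> tgt G f' = u" by (rule adjE) blast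
      then have "f' = e0" using inf_edge_unique(1)[OF G e0(1,2), of f'] e0(3) by auto
      then show False using f'(1) fu \<open>f = e0\<close> by auto
    qed
    have f_fin: "len G f \<noteq> \<infinity>" using fu u_fin pq(2) tgt_inf_end_iff[OF G f(1)] by auto
    have L: "0 < elen f" "ereal (elen f) = len G f" using elen[OF f(1) f_fin] by auto
    have ends: "edge_fun G F f 0 = real_of_ereal (F (Vx (src G f)))"
        "edge_fun G F f (elen f) = real_of_ereal (F (Vx (tgt G f)))"
      using point_at_simps(1)[OF G f(1)] point_at_simps(2)[OF G f(1) L(2)] by (auto simp: edge_fun_def)
    have "\<not> src_stub f" "\<not> tgt_stub f" using fu u by (auto simp: src_stub_def tgt_stub_def q_def)
    then have o: "0 \<le> ord G F (Ix f s)" if "0 < s" "s < elen f" for s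
      using orde[OF f(1) that(1)] that f(2) L(2) by (metis less_ereal.simps(1))
    note spread = edge_max_spreads[OF G F le f(1) order_refl L(1) eq_refl[OF L(2)] o]
    have Fu: "real_of_ereal (F (Vx u)) = 0"
      using fu
    proof
      assume *: "src G f = q \<and> tgt G f = u \<and> ?r f = 0"
      have "edge_fun G F f (elen f) = 0"
        by (rule spread(1)) (use L slopes(1)[OF f(1)] ends * Fq in auto)
      then show ?thesis using ends * by simp
    next
      assume *: "src G f = u \<and> tgt G f = q \<and> ?l f = 0"
      have "edge_fun G F f 0 = 0"
        by (rule spread(2)) (use L slopes(3)[OF f(1)] ends * Fq in \<open>auto simp: elen_def\<close>)
      then show ?thesis using ends * by simp
    qed
    have pu': "(p, u) \<in> (adj G {f \<in> ?A. len G f \<noteq> \<infinity>})\<^sup>*"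
      by (rule finite_length_path[OF G _ pu pq(1) u_fin]) auto
    have ov: "0 \<le> ord G F (Vx v)" if "v \<in> verts G" "v \<noteq> q" for v using ordv[OF that(1)] that(2) by simp
    have "real_of_ereal (F (Vx p)) = 0"
    proof (rule path_max_spreads[OF G F le _ _ _ pu' Fu])
      show "0 \<le> ord G F (Vx v)" if "f \<in> {f \<in> ?A. len G f \<noteq> \<infinity>}" "v = src G f \<or> v = tgt G f" for f v
        using that tropical_curve_edge[OF G, of f] by (intro ov) auto
      show "0 \<le> ord G F (Ix f s)" if "f \<in> {f \<in> ?A. len G f \<noteq> \<infinity>}" "0 < s" "ereal s < len G f" for f s
        using that by (intro orde) (auto simp: src_stub_def tgt_stub_def q_def)
    qed auto
    then show ?thesis using ov[OF pq(3) False] by simp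
  qed
  \<comment> \<open>From \<open>p\<close> the zero set enters \<open>e\<close> again and runs up to
    the kink from its left side.\<close>
  have "src G e = p" by (simp add: p_def)
  with Fp have flat: "rgerm (edge_fun G F e) 0 0"
    by (intro vertex_max_flat(1)[OF G F le pq(1) _ _ e(1)]) auto
  have Fe0: "edge_fun G F e 0 = 0"
    using Fp point_at_simps(1)[OF G e(1)] by (simp add: edge_fun_def p_def)
  have kink_le: "ereal kink \<le> len G e" using less_e[OF kink(2)] by simp
  have okink: "0 \<le> ord G F (Ix e s)" if "0 < s" "s < kink" for s
    using orde[OF e(1) that(1)] less_e[of s] kink(2) that(2) by auto
  show ?thesis
    by (rule edge_max_spreads(1)[OF G F le e(1) order_refl kink(1) kink_le okink t flat Fe0])
qed

text \<open>Near the kink \<open>T\<close> and \<open>f1\<close> are linear, while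
  \<open>bump\<close> bends. If \<open>T\<close> touched \<open>f\<close> at
  \<open>kink + d/2\<close>, their difference would vanish to the right of the kink and be negative
  to its left, against \<open>max_spreads_around\<close>.\<close>

lemma term_below_at_kink:
  defines "q \<equiv> tgt G e" and "p \<equiv> src G e"
  assumes f1: "rational_fun G f1" and f: "PL_fun G f" and T: "PL_fun G T"
    and f_eq: "\<And>x. x \<in> fin_pts G \<Longrightarrow>
      real_of_ereal (f x) = real_of_ereal (bump x) - of_int m * real_of_ereal (f1 x)"
    and U: "PL_off U (edge_fun G f1 e) (len G e)" "PL_off U (edge_fun G T e) (len G e)"
    and d: "0 < d" "d \<le> kink" "kink + d \<le> elen e" "U \<inter> {kink - d<..<kink + d} = {}"
    and dom: "\<And>x. x \<in> fin_pts G \<Longrightarrow> real_of_ereal (T x) \<le> real_of_ereal (f x)"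
    and ordv: "\<And>v. v \<in> verts G \<Longrightarrow>
      (if v = q then of_int (stub_count - c) else 0) \<le> ord G T (Vx v) - ord G f (Vx v)"
    and orde: "\<And>f' t. f' \<in> edges G \<Longrightarrow> 0 < t \<Longrightarrow> ereal t < len G f' \<Longrightarrow>
      (if f' = e then t \<noteq> kink else \<not> src_stub f' \<and> \<not> tgt_stub f') \<Longrightarrow> ord G f (Ix f' t) \<le> ord G T (Ix f' t)"
    and W: "W = {w \<in> verts G. w \<noteq> q \<and> (p, w) \<notin> (adj G {f \<in> edges G - {e}. src G f \<noteq> q \<and> tgt G f \<noteq> q})\<^sup>*}"
    and path: "(p, q) \<in> (adj G (edges G - {e}))\<^sup>*"
    and cs: "c = (if stub_count = 0 then 1 else stub_count)"
    and val: "valence G q \<noteq> 2"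
  shows "real_of_ereal (T (point_at G e (kink + d/2))) < real_of_ereal (f (point_at G e (kink + d/2)))"
proof (rule ccontr)
  assume not_less: "\<not> ?thesis"
  define F where "F = (\<lambda>x. ereal (real_of_ereal (T x) - real_of_ereal (f x)))"
  have F_lin: "real_of_ereal (F x) = of_int 1 * real_of_ereal (T x) + of_int (-1) * real_of_ereal (f x)" for x
    by (simp add: F_def)
  have F: "PL_fun G F" by (rule ord_lin(1)[OF G T f F_lin])
  have ordF: "ord G F x = ord G T x - ord G f x" if "x \<in> pts G" for x
    using ord_lin(2)[OF G T f F_lin that] by simp
  have le: "\<forall>x\<in>fin_pts G. real_of_ereal (F x) \<le> 0" using dom by (simp add: F_def)
  let ?g = "edge_fun G F e"
  have in_e: "0 \<le> t \<and> ereal t \<le> len G e" if "kink - d \<le> t" "t \<le> kink + d" for t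
  proof -
    have "ereal t \<le> ereal (elen e)" using that d by simp
    then show ?thesis using that d elen[OF e] by simp
  qed
  have "ereal (kink + d) \<le> len G e" using in_e[of "kink + d"] d(1) by simp
  note near = _ _ this d(4)
  obtain s :: int where s: "\<And>t. kink - d \<le> t \<Longrightarrow> t \<le> kink + d \<Longrightarrow>
      edge_fun G T e t = edge_fun G T e (kink - d) + of_int s * (t - (kink - d))"
    using PL_offD[OF U(2) near] d(1,2) by auto
  obtain s1 :: int where s1: "\<And>t. kink - d \<le> t \<Longrightarrow> t \<le> kink + d \<Longrightarrow>
      edge_fun G f1 e t = edge_fun G f1 e (kink - d) + of_int s1 * (t - (kink - d))"
    using PL_offD[OF U(1) near] d(1,2) by auto
  have g: "?g t = edge_fun G T e t - profile e t + of_int m * edge_fun G f1 e t"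
    if "kink - d \<le> t" "t \<le> kink + d" for t
    using f_eq[OF point_at_fin[OF G e(1), of t]] in_e[OF that] edge_bump[OF e(1), of t]
    by (simp add: F_def edge_fun_def)
  have np: "?g t \<le> 0" if "kink - d \<le> t" "t \<le> kink + d" for t
    using edge_fun_nonpos[OF G le e(1)] in_e[OF that] by blast
  \<comment> \<open>The slope of the difference to the right of the kink; to the left it is larger
    by \<open>2 * M - c\<close>.\<close>
  define \<sigma> where "\<sigma> = of_int s + of_int m * of_int s1 - (of_int (M - c) :: real)"
  have right: "?g t = ?g kink + \<sigma> * (t - kink)" if "kink \<le> t" "t \<le> kink + d" for t
    using g[of t] g[of kink] s[of t] s[of kink] s1[of t] s1[of kink] profile_right[of t] profile_right[of kink] that d(1)
    by (simp add: \<sigma>_def algebra_simps)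
  have left: "?g (kink - d) = ?g kink - (\<sigma> + of_int (2 * M - c)) * d"
    using g[of "kink - d"] g[of kink] s[of kink] s1[of kink] d(1)
    by (simp add: \<sigma>_def profile_def algebra_simps)
  \<comment> \<open>A linear function that is nonpositive at both ends of a segment and nonnegative
    at its midpoint is zero.\<close>
  have "0 \<le> ?g (kink + d/2)" using not_less d(1) by (simp add: F_def edge_fun_def)
  then have "0 \<le> ?g kink + (\<sigma> * d) / 2" using right[of "kink + d/2"] d(1) by simp
  moreover have "?g kink + \<sigma> * d \<le> 0" "?g kink \<le> 0"
    using np[of "kink + d"] right[of "kink + d"] np[of kink] d(1) by auto
  ultimately have g0: "?g kink = 0" and "\<sigma> * d = 0" by linarith+
  then have \<sigma>: "\<sigma> = 0" using d(1) by simp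
  have start: "rgerm ?g kink 0"
  proof (rule rgermI[OF d(1)])
    show "?g u = ?g kink + 0 * (u - kink)" if "kink \<le> u" "u \<le> kink + d" for u
      using right[OF that] \<sigma> by simp
  qed
  have z: "?g (kink - d) = 0"
  proof (rule max_spreads_around[OF F le _ _ start g0 W[unfolded q_def p_def] path[unfolded q_def p_def] cs val[unfolded q_def]])
    fix v assume v: "v \<in> verts G"
    then have "Vx v \<in> pts G" by (simp add: pts_def)
    then show "(if v = tgt G e then real_of_int (stub_count - c) else 0) \<le> ord G F (Vx v)"
      using ordv[OF v] ordF by (simp add: q_def)
  next
    fix f' t assume *: "f' \<in> edges G" "0 < t" "ereal t < len G f'"
      "if f' = e then t \<noteq> kink else \<not> src_stub f' \<and> \<not> tgt_stub f'"
    then have "Ix f' t \<in> pts G" by (simp add: pts_def)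
    then show "0 \<le> ord G F (Ix f' t)" using orde[OF *] ordF by simp
  qed (use d in auto)
  have "0 < 2 * M - c" using M by linarith
  then have "0 < (of_int (2 * M - c) :: real)" by (simp only: of_int_0_less_iff)
  then have "0 < of_int (2 * M - c) * d" using d(1) by (rule mult_pos_pos)
  with left[unfolded z g0 \<sigma> add_0] show False by linarith
qed

end

section \<open>The family of sections with moving kinks and the contradiction\<close>

theorem theorem2p7:
  fixes G :: "('v, 'e) metric_graph"
    and D :: "('v, 'e) point \<Rightarrow> int"
    and e :: 'e
    and n :: nat
  assumes "Z_tropical_curve G"
    and "genus G \<ge> 2"
    and "Z_divisor G D"
    and "deg D \<ge> 2"
    and "e \<in> edges G"
    and "\<not> is_bridge G e"
    and "n > 0"
    and "lin_equiv G (smult_div (int n) D)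
           (\<lambda>x. (if x = Vx (src G e) then int n * deg D div 2 else 0)
              + (if x = Vx (tgt G e) then int n * deg D div 2 else 0))"
  shows "\<not> fin_gen_section_ring G D"
proof
  assume fg: "fin_gen_section_ring G D"
  define p q N where "p = src G e" and "q = tgt G e" and "N = int n * deg D div 2"
  have G: "tropical_curve G" using assms(1) by (simp add: Z_tropical_curve_def)
  have len1: "1 \<le> len G f" if f: "f \<in> edges G" for f
  proof -
    have "0 < len G f" using tropical_curve_edge(3)[OF G f] .
    moreover have "len G f = \<infinity> \<or> (\<exists>k::int. len G f = ereal (of_int k))"
      using assms(1) f by (simp add: Z_tropical_curve_def)
    ultimately show ?thesis by (auto simp: one_ereal_def zero_ereal_def)
  qed
  have e: "e \<in> edges G" "len G e \<noteq> \<infinity>"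
    using assms(5) non_bridge_finite_length[OF G assms(5,6)] by auto
  have pq: "p \<in> verts G" "q \<in> verts G" using tropical_curve_edge[OF G e(1)] by (auto simp: p_def q_def)
  have path: "(p, q) \<in> (adj G (edges G - {e}))\<^sup>*"
    using assms(6) pq by (auto simp: is_bridge_def graph_connected_def)
  have val: "valence G q \<noteq> 2" using G pq(2) by (simp add: tropical_curve_def)
  have "1 * 2 \<le> int n * deg D" using assms(4,7) by (intro mult_mono) auto
  then have N: "1 \<le> N" by (simp add: N_def)
  obtain f1 where f1: "rational_fun G f1" and div_f1: "\<And>x. x \<in> pts G \<Longrightarrow>
      ord G f1 x = of_int (int n * D x - ((if x = Vx p then N else 0) + (if x = Vx q then N else 0)))"
    using assms(8) unfolding lin_equiv_def smult_div_def p_def q_def N_def by metis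

  let ?A = "{f \<in> edges G - {e}. src G f \<noteq> q \<and> tgt G f \<noteq> q}"
  define W where "W = {w \<in> verts G. w \<noteq> q \<and> (p, w) \<notin> (adj G ?A)\<^sup>*}"
  have W_closed: "y \<in> insert q W"
    if f: "f \<in> edges G" "f \<noteq> e" "(src G f = z \<and> tgt G f = y) \<or> (src G f = y \<and> tgt G f = z)" and z: "z \<in> W" for f z y
  proof (rule ccontr)
    assume *: "y \<notin> insert q W"
    have "y \<in> verts G" using f tropical_curve_edge[OF G f(1)] by auto
    \<comment> \<open>Such a \<open>y\<close> is joined to \<open>p\<close> away from
      \<open>q\<close>, and the edge \<open>f\<close> would extend the path to
      \<open>z\<close>.\<close>
    then have "(p, y) \<in> (adj G ?A)\<^sup>*" using * unfolding W_def by blast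
    moreover have "(y, z) \<in> adj G ?A" using f * z by (intro adjI[of f]) (auto simp: W_def)
    ultimately have "(p, z) \<in> (adj G ?A)\<^sup>*" by (rule rtrancl_into_rtrancl)
    then show False using z by (simp add: W_def)
  qed
  have kinked: "kinked_edge G e W M c" if "0 \<le> c" "0 < M" "c < M" for M c
    by unfold_locales
      (use G len1 e W_closed that in \<open>auto simp: W_def p_def[symmetric] q_def[symmetric]\<close>)
  \<comment> \<open>The number of stubs depends only on \<open>G\<close>, \<open>e\<close> and
    \<open>W\<close>, so it is available before \<open>M\<close> and \<open>c\<close> are fixed. The
    values \<open>M = 1\<close>, \<open>c = 0\<close> below merely give an instance in which to
    unfold its definition.\<close>
  define h where "h = kinked_edge.stub_count G e W"
  have h: "0 \<le> h" using kinked_edge.stub_count_def[OF kinked[of 0 1]] by (simp add: h_def)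
  define c where "c = (if h = 0 then 1 else h)"
  have c: "1 \<le> c" "h \<le> c" using h by (auto simp: c_def)
  define l where "l = real_of_ereal (len G e)"
  have l: "0 < l" using len1[OF e(1)] e(2) by (cases "len G e") (auto simp: l_def one_ereal_def)
  define M where "M m = int m * N" for m
  define x where "x m = kinked_edge.kink G e (M m) c" for m
  have M: "c < M m" "0 < M m" if "nat c < m" for m
  proof -
    have "c < int m" using that by simp
    moreover have "int m * 1 \<le> M m" unfolding M_def using N by (intro mult_left_mono) auto
    ultimately show "c < M m" "0 < M m" using c(1) by linarith+
  qed
  have kinkedM: "kinked_edge G e W (M m) c" if "nat c < m" for m
    using M[OF that] c(1) by (intro kinked) auto
  \<comment> \<open>Equality of two kinks reduces to \<open>c * (M m - M m') = 0\<close>. Here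
    \<open>c\<close> at least 1 is essential: for \<open>c = 0\<close> every kink would be the
    midpoint of \<open>e\<close>.\<close>
  have "inj_on x {nat c<..}"
  proof (rule inj_onI)
    fix m m' assume m: "m \<in> {nat c<..}" "m' \<in> {nat c<..}" and eq: "x m = x m'"
    have x: "x m = of_int (M m - c) * l / of_int (2 * M m - c)" if "m \<in> {nat c<..}" for m
      using kinked_edge.kink_def[OF kinkedM] kinked_edge.elen_def[OF kinkedM] that by (simp add: x_def l_def)
    have pos: "0 < 2 * M m - c" if "m \<in> {nat c<..}" for m using M[of m] that by auto
    have "(of_int (2 * M m - c) :: real) \<noteq> 0" "(of_int (2 * M m' - c) :: real) \<noteq> 0"
      using pos[OF m(1)] pos[OF m(2)] by (simp_all only: of_int_eq_0_iff)
    then have "of_int (M m - c) * of_int (2 * M m' - c) = (of_int (M m' - c) * of_int (2 * M m - c) :: real)"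
      using eq l unfolding x[OF m(1)] x[OF m(2)] by (simp add: frac_eq_eq)
    then have "(M m - c) * (2 * M m' - c) = (M m' - c) * (2 * M m - c)"
      by (simp only: of_int_mult[symmetric] of_int_eq_iff)
    then have "c * (M m - M m') = 0" by (simp add: algebra_simps)
    then show "m = m'" using c(1) N by (simp add: M_def)
  qed
  then have inf: "infinite (x ` {nat c<..})" using infinite_Ioi finite_imageD by blast

  obtain S where S: "finite S" "\<forall>(k, g)\<in>S. g \<in> RR G (smult_div (int k) D)"
    and gen: "\<forall>m::nat. \<forall>f \<in> RR G (smult_div (int m) D).
           \<exists>ts :: (real \<times> (nat \<times> (('v, 'e) point \<Rightarrow> ereal)) list) list.
             ts \<noteq> [] \<and>
             (\<forall>(c, gs) \<in> set ts. set gs \<subseteq> S \<and> sum_list (map fst gs) = m) \<and>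
             (\<forall>x\<in>fin_pts G. f x = Max (set (map (\<lambda>(c, gs). ereal c + sum_list (map (\<lambda>(k, h). h x) gs)) ts)))"
    using fg unfolding fin_gen_section_ring_def by (elim exE conjE)
  \<comment> \<open>The degree 0 attached to \<open>f1\<close> is a dummy; it only lets
    \<open>f1\<close> share the set \<open>U\<close> with the generators.\<close>
  have "\<forall>s\<in>insert (0, f1) S. \<exists>B. finite B \<and> PL_off B (edge_fun G (snd s) e) (len G e)"
    using S(2) rational_fun_PL_fun[OF f1] rational_fun_PL_fun e(1) by (fastforce simp: RR_def PL_fun_def)
  then obtain B where B: "\<And>s. s \<in> insert (0, f1) S \<Longrightarrow> finite (B s) \<and> PL_off (B s) (edge_fun G (snd s) e) (len G e)"
    by metis
  define U where "U = (\<Union>s\<in>insert (0, f1) S. B s)"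
  have "finite U" using S(1) B by (auto simp: U_def)
  have U: "PL_off U (edge_fun G (snd s) e) (len G e)" if "s \<in> insert (0, f1) S" for s
    using B[OF that] that by (auto simp: U_def intro: PL_off_mono)
  obtain m where m: "nat c < m" "x m \<notin> U"
    using inf \<open>finite U\<close> finite_subset[of "x ` {nat c<..}" U] by blast

  interpret kinked_edge G e W "M m" c by (rule kinkedM[OF m(1)])
  have kink_x: "kink = x m" by (simp add: x_def)
  have stub_h: "stub_count = h" by (simp add: h_def)
  \<comment> \<open>Subtracting \<open>m * f1\<close> turns \<open>m * n * D\<close> into
    \<open>M m\<close> chips at each end of \<open>e\<close>, which \<open>bump\<close> then moves.
    Since \<open>bump\<close> is finite, the sum is also meaningful where \<open>f1\<close> is
    infinite.\<close>
  define f where "f = (\<lambda>x. ereal (- real m) * f1 x + bump x)"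
  have f_eq: "real_of_ereal (f y) = of_int 1 * real_of_ereal (bump y) + of_int (- int m) * real_of_ereal (f1 y)"
    and f_fin: "\<bar>f y\<bar> \<noteq> \<infinity>" if "y \<in> fin_pts G" for y
  proof -
    have "\<bar>f1 y\<bar> \<noteq> \<infinity>" using f1 that by (simp add: rational_fun_def)
    moreover have "\<bar>bump y\<bar> \<noteq> \<infinity>" by (simp add: bump_def)
    ultimately show "real_of_ereal (f y) = of_int 1 * real_of_ereal (bump y) + of_int (- int m) * real_of_ereal (f1 y)"
      "\<bar>f y\<bar> \<noteq> \<infinity>" unfolding f_def by (cases "f1 y"; cases "bump y"; simp)+
  qed
  note f_lin = ord_lin[OF G PL_fun_bump rational_fun_PL_fun[OF f1] f_eq]
  have ord_f: "of_int (int (m * n) * D y) + ord G f y =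
      ord G bump y + of_int ((if y = Vx p then M m else 0) + (if y = Vx q then M m else 0))"
    if "y \<in> pts G" for y
    using f_lin(2)[OF _ that] div_f1[OF that] by (simp add: M_def algebra_simps)
  have ord_v: "of_int (int (m * n) * D (Vx v)) + ord G f (Vx v) = (if v = q then of_int (c - h) else 0)"
    if "v \<in> verts G" for v
    using ord_f[of "Vx v"] that ord_bump_vertex[of v] by (simp add: pts_def p_def q_def stub_h)
  have ord_e: "of_int (int (m * n) * D (Ix f' t)) + ord G f (Ix f' t) = ord G bump (Ix f' t)"
    if "f' \<in> edges G" "0 < t" "ereal t < len G f'" for f' t
    using ord_f[of "Ix f' t"] that by (simp add: pts_def)
  have "rational_fun G f"
    unfolding rational_fun_def
  proof (intro conjI ballI impI f_fin)
    fix f' assume f': "f' \<in> edges G"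
    show "pw_linear (edge_fun G f f') (len G f')"
      using PL_funE[OF f_lin(1) f'] PL_off_imp_pw_linear tropical_curve_edge(3)[OF G f'] by metis
    assume inf: "len G f' = \<infinity>"
    have "((\<lambda>t. f1 (point_at G f' t)) \<longlongrightarrow> f1 (Vx (tgt G f'))) at_top"
      using f1 f' inf by (auto simp: rational_fun_def)
    \<comment> \<open>Near an infinite end \<open>bump\<close> is constant, so the limit of
      \<open>f1\<close> yields that of \<open>f\<close>, even when it is infinite.\<close>
    then have "((\<lambda>t. ereal (- real m) * f1 (point_at G f' t) + bump (Vx (tgt G f'))) \<longlongrightarrow> f (Vx (tgt G f'))) at_top"
      unfolding f_def by (intro tendsto_add_left_ereal tendsto_cmult_ereal) (auto simp: bump_def)
    then show "((\<lambda>t. f (point_at G f' t)) \<longlongrightarrow> f (Vx (tgt G f'))) at_top"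
      by (rule Lim_transform_eventually)
        (use bump_near_infinity[OF f' inf] in \<open>auto elim!: eventually_mono simp: f_def\<close>)
  qed
  moreover have "0 \<le> of_int (int (m * n) * D y) + ord G f y" if "y \<in> pts G" for y
  proof (cases y)
    case (Vx v)
    then show ?thesis using ord_v[of v] that c(2) by (auto simp: pts_def)
  next
    case (Ix f' t)
    then have "f' \<in> edges G" "0 < t" "ereal t < len G f'" using that by (auto simp: pts_def)
    then show ?thesis using ord_e ord_bump_edge_nonneg Ix by simp
  qed
  ultimately have "f \<in> RR G (smult_div (int (m * n)) D)"
    by (simp add: RR_def smult_div_def)
  from gen[rule_format, OF this] obtain ts :: "(real \<times> (nat \<times> (('v, 'e) point \<Rightarrow> ereal)) list) list"
    where ts: "ts \<noteq> []" "\<forall>(a, gs)\<in>set ts. set gs \<subseteq> S \<and> sum_list (map fst gs) = m * n"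
      and f_Max: "\<forall>y\<in>fin_pts G.
        f y = Max (set (map (\<lambda>(c, gs). ereal c + sum_list (map (\<lambda>(k, h). h y) gs)) ts))"
    by (elim exE conjE)

  obtain d0 where d0: "0 < d0" "\<forall>u\<in>U. u \<noteq> kink \<longrightarrow> d0 \<le> \<bar>u - kink\<bar>"
    using finite_gap[OF \<open>finite U\<close>] by blast
  \<comment> \<open>Small enough for the neighbourhood to avoid \<open>U\<close> and to stay inside
    \<open>e\<close> on both sides of the kink.\<close>
  define d where "d = min d0 (min kink (elen e - kink))"
  have "u \<notin> {kink - d<..<kink + d}" if "u \<in> U" for u
  proof -
    have "d0 \<le> \<bar>u - kink\<bar>" using d0(2) that m(2) kink_x by metis
    then show ?thesis by (auto simp: d_def)
  qed
  then have d: "0 < d" "d \<le> kink" "kink + d \<le> elen e" "U \<inter> {kink - d<..<kink + d} = {}"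
    using d0(1) kink(1,2) by (auto simp: d_def)
  define y where "y = point_at G e (kink + d/2)"
  have "ereal (kink + d/2) \<le> ereal (elen e)" using d by simp
  then have "ereal (kink + d/2) \<le> len G e" using elen[OF e] by simp
  then have y: "y \<in> fin_pts G" unfolding y_def using d by (intro point_at_fin[OF G e(1)]) auto
  let ?T = "\<lambda>a gs z. ereal a + sum_list (map (\<lambda>(k, h). h z) gs)"
  \<comment> \<open>Some term attains the maximum at the chosen point to the right of the kink;
    being one of the terms, it is below \<open>f\<close> everywhere else.\<close>
  have "f y \<in> set (map (\<lambda>(c, gs). ?T c gs y) ts)"
    unfolding f_Max[rule_format, OF y] using ts(1) by (intro Max_in) auto
  then obtain a gs where agt: "(a, gs) \<in> set ts" and fy: "f y = ?T a gs y" by auto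
  have ags: "set gs \<subseteq> S" "sum_list (map fst gs) = m * n" using ts(2) agt by auto
  have dom: "?T a gs z \<le> f z" if "z \<in> fin_pts G" for z
    unfolding f_Max[rule_format, OF that] using agt by (intro Max_ge) force+
  have gs: "g \<in> RR G (smult_div (int k) D) \<and> PL_off U (edge_fun G g e) (len G e)" if "(k, g) \<in> set gs" for k g
    using ags(1) S(2) U[of "(k, g)"] that by auto
  have T: "(\<forall>z\<in>fin_pts G. \<bar>?T a gs z\<bar> \<noteq> \<infinity>) \<and> PL_fun G (?T a gs) \<and> PL_off U (edge_fun G (?T a gs) e) (len G e) \<and>
    (\<forall>z\<in>pts G. - of_int (int (sum_list (map fst gs)) * D z) \<le> ord G (?T a gs) z)"
    using gs by (rule term_section[OF G e(1)])
  note T_fin = T[THEN conjunct1, THEN bspec]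
  note T_PL = T[THEN conjunct2, THEN conjunct1] T[THEN conjunct2, THEN conjunct2, THEN conjunct1]
  note T_ord = T[THEN conjunct2, THEN conjunct2, THEN conjunct2, THEN bspec, unfolded ags(2)]
  have "real_of_ereal (?T a gs y) < real_of_ereal (f y)"
    unfolding y_def
  proof (rule term_below_at_kink[where m = "int m" and U = U, OF f1 f_lin(1) T_PL(1) _ _ T_PL(2) d])
    show "PL_off U (edge_fun G f1 e) (len G e)" using U[of "(0, f1)"] by simp
    show "real_of_ereal (?T a gs z) \<le> real_of_ereal (f z)" if "z \<in> fin_pts G" for z
      using dom[OF that] T_fin[OF that] f_fin[OF that] by (cases "?T a gs z"; cases "f z") auto
    show "(if v = tgt G e then real_of_int (stub_count - c) else 0) \<le> ord G (?T a gs) (Vx v) - ord G f (Vx v)"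
      if "v \<in> verts G" for v
      using T_ord[of "Vx v"] ord_v[OF that] that by (auto simp: pts_def q_def stub_h split: if_splits)
    show "ord G f (Ix f' t) \<le> ord G (?T a gs) (Ix f' t)"
      if f': "f' \<in> edges G" "0 < t" "ereal t < len G f'"
        and off: "if f' = e then t \<noteq> kink else \<not> src_stub f' \<and> \<not> tgt_stub f'" for f' t
    proof -
      have "ord G bump (Ix f' t) = 0"
        using ord_bump_e ord_bump_no_stub f' off by (cases "f' = e") auto
      then show ?thesis using T_ord[of "Ix f' t"] ord_e[OF f'] f' by (simp add: pts_def)
    qed
    show "W = {w \<in> verts G. w \<noteq> tgt G e \<and>
        (src G e, w) \<notin> (adj G {f \<in> edges G - {e}. src G f \<noteq> tgt G e \<and> tgt G f \<noteq> tgt G e})\<^sup>*}"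
      by (simp add: W_def p_def q_def)
  qed (use f_eq path val in \<open>auto simp: p_def q_def c_def stub_h\<close>)
  then show False using fy by simp
qed

end
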